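(* Let $\mu>0$ and $\sigma>0$ be fixed, and let $R_K(\delta)$ ($\delta\in\mathbb{R}$) and $R_R(n)$ ($n\ge 1$ an integer) be the prospective risks of KEEP and RECENTER in the one-dimensional Gaussian translation model, as defined in the context. For every finite batch size $n\ge 1$ there exists a unique critical shift $\delta_c(n)>0$ such that $R_K(\delta_c(n))=R_R(n)$. Furthermore, for every $\delta\in\mathbb{R}$, $$|\delta|<\delta_c(n)\implies R_K(\delta)<R_R(n),\qquad |\delta|>\delta_c(n)\implies R_K(\delta)>R_R(n).$$ As $n\to\infty$, $$\delta_c(n)=\frac{\sqrt{\mu^2+\sigma^2}}{\sqrt n}+O(n^{-3/2})=\Theta(n^{-1/2}).$$
   Context: Model: the label $Y$ is uniform on $\{-1,+1\}$ and, in the target domain with translation shift $\delta\in\mathbb{R}$, the observed feature is $X=\delta+\mu Y+\epsilon$ with $\epsilon\sim\mathcal{N}(0,\sigma^2)$ independent of $Y$. A classifier with threshold $t$ predicts $+1$ if $x>t$ and $-1$ otherwise; risk is the probability of misclassifying a fresh target point $(X',Y')$. KEEP uses threshold $0$. Its risk is $$R_K(\delta)=\tfrac12\left[\Phi\!\left(-\frac{\mu+\delta}{\sigma}\right)+\Phi\!\left(\frac{\delta-\mu}{\sigma}\right)\right],$$ where $\Phi$ is the standard normal distribution function. RECENTER receives $n$ i.i.d. unlabeled target samples $X_1,\dots,X_n$ from the target model, computes $\hat\delta=\bar X_n=\frac1n\sum_{i=1}^nX_i$, and classifies an independent fresh target point using threshold $\hat\delta$. Its risk (the expectation being over both the batch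 and the fresh point) does not depend on $\delta$ and is $$R_R(n)=2^{-n}\sum_{k=0}^n\binom nk\,\Phi\!\left(\frac{\mu(2k-n)/n-\mu}{\sigma\sqrt{1+1/n}}\right).$$ The constants implied by $O(\cdot)$ and $\Theta(\cdot)$ may depend on $\mu$ and $\sigma$. *)

theory Defs
  imports "HOL-Probability.Probability" "HOL-Library.Landau_Symbols"
begin

abbreviation normal :: "real \<Rightarrow> real \<Rightarrow> real measure" where
  "normal m s \<equiv> density lborel (normal_density m s)"

text \<open>
  The joint law of a feature and its label, \<open>(\<delta> + \<mu> y + \<epsilon>, y)\<close>, where \<open>y\<close> is uniform on \<open>{-1, 1}\<close> and
  \<open>\<epsilon>\<close> is independent of \<open>y\<close> and normal with mean \<open>0\<close> and standard deviation \<open>\<sigma>\<close>.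
\<close>

definition target :: "real \<Rightarrow> real \<Rightarrow> real \<Rightarrow> (real \<times> real) measure" where
  "target \<mu> \<sigma> \<delta> =
     distr (uniform_count_measure {-1, 1} \<Otimes>\<^sub>M normal 0 \<sigma>)
       (borel \<Otimes>\<^sub>M borel) (\<lambda>(y, e). (\<delta> + \<mu> * y + e, y))"

definition classify :: "real \<Rightarrow> real \<Rightarrow> real" where
  "classify t x = (if x > t then 1 else - 1)"

definition keep_risk :: "real \<Rightarrow> real \<Rightarrow> real \<Rightarrow> real" where
  "keep_risk \<mu> \<sigma> \<delta> = \<P>((x, y) in target \<mu> \<sigma> \<delta>. classify 0 x \<noteq> y)"

text \<open>
  The batch \<open>w\<close> consists of \<open>n\<close> independent target points, of which the estimator uses only the
  features; the fresh point \<open>(x, y)\<close> is independent of the batch. By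
  \<open>recenter_risk_closed_form\<close> below, the risk is the same for every \<open>\<delta>\<close>.
\<close>

definition batch_mean :: "nat \<Rightarrow> (nat \<Rightarrow> real \<times> real) \<Rightarrow> real" where
  "batch_mean n w = (\<Sum>i<n. fst (w i)) / real n"

definition recenter_risk :: "real \<Rightarrow> real \<Rightarrow> real \<Rightarrow> nat \<Rightarrow> real" where
  "recenter_risk \<mu> \<sigma> \<delta> n =
     \<P>((w, (x, y)) in (\<Pi>\<^sub>M i\<in>{..<n}. target \<mu> \<sigma> \<delta>) \<Otimes>\<^sub>M target \<mu> \<sigma> \<delta>.
        classify (batch_mean n w) x \<noteq> y)"

definition critical_shift :: "real \<Rightarrow> real \<Rightarrow> nat \<Rightarrow> real" where
  "critical_shift \<mu> \<sigma> n = (THE d. d > 0 \<and> keep_risk \<mu> \<sigma> d = recenter_risk \<mu> \<sigma> d n)"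

lemma nn_integral_normal_affine:
  assumes "s > 0" "c \<noteq> 0" and [measurable]: "f \<in> borel_measurable borel"
  shows "(\<integral>\<^sup>+x. f (a + c * x) \<partial>normal m s) = (\<integral>\<^sup>+x. f x \<partial>normal (a + c * m) (\<bar>c\<bar> * s))"
proof -
  interpret prob_space "normal m s" using assms by (intro prob_space_normal_density)
  have "distributed (normal m s) lborel (\<lambda>x. x) (normal_density m s)"
    by (auto simp: distributed_def distr_id2)
  from normal_density_affine[OF this assms(1,2), of a]
  have *: "distr (normal m s) lborel (\<lambda>x. a + c * x) = normal (a + c * m) (\<bar>c\<bar> * s)"
    by (simp add: distributed_def)
  have "(\<integral>\<^sup>+x. f x \<partial>distr (normal m s) lborel (\<lambda>x. a + c * x)) = (\<integral>\<^sup>+x. f (a + c * x) \<partial>normal m s)"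
    by (rule nn_integral_distr) auto
  thus ?thesis by (simp add: *)
qed

lemma nn_integral_normal_conv:
  assumes "s > 0" "r > 0" and [measurable]: "f \<in> borel_measurable borel"
  shows "(\<integral>\<^sup>+x. \<integral>\<^sup>+y. f (x + y) \<partial>normal b r \<partial>normal a s) =
         (\<integral>\<^sup>+x. f x \<partial>normal (a + b) (sqrt (s\<^sup>2 + r\<^sup>2)))"
proof -
  interpret A: prob_space "normal a s" using assms by (intro prob_space_normal_density)
  interpret B: prob_space "normal b r" using assms by (intro prob_space_normal_density)
  have fm: "finite_measure (normal a s)" "finite_measure (normal b r)" by unfold_locales
  have shift: "normal_density m q x = normal_density 0 q (x - m)" for m q x
    by (simp add: normal_density_def)
  have "(\<integral>\<^sup>+y. ennreal (normal_density a s (x - y)) * ennreal (normal_density b r y) \<partial>lborel) =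
        ennreal (normal_density (a + b) (sqrt (s\<^sup>2 + r\<^sup>2)) x)" for x
  proof -
    have "(\<integral>\<^sup>+y. ennreal (normal_density a s (x - y)) * ennreal (normal_density b r y) \<partial>lborel) =
          (\<integral>\<^sup>+z. ennreal (normal_density 0 s ((x - (a + b)) - z) * normal_density 0 r z) \<partial>lborel)"
      by (subst nn_integral_real_affine[where c = 1 and t = b])
         (auto simp: shift[of a] shift[of b] ennreal_mult algebra_simps)
    also have "\<dots> = ennreal (normal_density 0 (sqrt (s\<^sup>2 + r\<^sup>2)) (x - (a + b)))"
      by (rule fun_cong[OF conv_normal_density_zero_mean[OF assms(1,2)]])
    finally show ?thesis by (simp add: shift[of "a + b"])
  qed
  hence "normal a s \<star> normal b r = normal (a + b) (sqrt (s\<^sup>2 + r\<^sup>2))"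
    using fm by (subst convolution_density) auto
  moreover have "(\<integral>\<^sup>+x. f x \<partial>(normal a s \<star> normal b r)) = (\<integral>\<^sup>+x. \<integral>\<^sup>+y. f (x + y) \<partial>normal b r \<partial>normal a s)"
    using fm by (intro nn_integral_convolution) auto
  ultimately show ?thesis by simp
qed

lemma sets_target [measurable_cong]: "sets (target \<mu> \<sigma> \<delta>) = sets (borel \<Otimes>\<^sub>M borel)"
  and space_target [simp]: "space (target \<mu> \<sigma> \<delta>) = UNIV"
  by (simp_all add: target_def space_pair_measure)

lemma measurable_target:
  "(\<lambda>(y, e). (\<delta> + \<mu> * y + e, y)) \<in>
     (uniform_count_measure {-1, 1} \<Otimes>\<^sub>M normal 0 \<sigma>) \<rightarrow>\<^sub>M (borel \<Otimes>\<^sub>M borel)" for \<mu> \<delta> \<sigma> :: real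
proof -
  have [measurable]: "(\<lambda>y. y) \<in> uniform_count_measure {-1, 1::real} \<rightarrow>\<^sub>M borel"
    by (simp add: uniform_count_measure_def)
  show ?thesis by measurable
qed

lemma prob_space_target: "\<sigma> > 0 \<Longrightarrow> prob_space (target \<mu> \<sigma> \<delta>)"
  unfolding target_def
  by (intro prob_space.prob_space_distr prob_space_pair prob_space_uniform_count_measure
       prob_space_normal_density measurable_target) auto

lemma nn_integral_target:
  assumes "\<sigma> > 0" and [measurable]: "f \<in> borel_measurable (borel \<Otimes>\<^sub>M borel)"
  shows "(\<integral>\<^sup>+p. f p \<partial>target \<mu> \<sigma> \<delta>) =
    ennreal (1/2) * (\<integral>\<^sup>+x. f (x, -1) \<partial>normal (\<delta> - \<mu>) \<sigma>) + ennreal (1/2) * (\<integral>\<^sup>+x. f (x, 1) \<partial>normal (\<delta> + \<mu>) \<sigma>)"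
proof -
  interpret N: prob_space "normal 0 \<sigma>" using assms by (intro prob_space_normal_density)
  have "(\<integral>\<^sup>+p. f p \<partial>target \<mu> \<sigma> \<delta>) =
    (\<integral>\<^sup>+p. f ((\<lambda>(y, e). (\<delta> + \<mu> * y + e, y)) p) \<partial>(uniform_count_measure {-1, 1} \<Otimes>\<^sub>M normal 0 \<sigma>))"
    unfolding target_def by (rule nn_integral_distr[OF measurable_target]) simp
  also have "\<dots> = (\<integral>\<^sup>+y. \<integral>\<^sup>+e. f (\<delta> + \<mu> * y + e, y) \<partial>normal 0 \<sigma> \<partial>uniform_count_measure {-1, 1})"
    by (subst N.nn_integral_fst[symmetric])
       (auto intro!: measurable_compose[OF measurable_target])
  also have "\<dots> = ennreal (1/2) * (\<integral>\<^sup>+e. f ((\<delta> - \<mu>) + 1 * e, -1) \<partial>normal 0 \<sigma>)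
                + ennreal (1/2) * (\<integral>\<^sup>+e. f ((\<delta> + \<mu>) + 1 * e, 1) \<partial>normal 0 \<sigma>)"
    by (simp add: uniform_count_measure_def nn_integral_point_measure_finite)
  also have "(\<integral>\<^sup>+e. f ((\<delta> - \<mu>) + 1 * e, -1) \<partial>normal 0 \<sigma>) = (\<integral>\<^sup>+x. f (x, -1) \<partial>normal (\<delta> - \<mu>) \<sigma>)"
    using nn_integral_normal_affine[OF assms(1), of 1 "\<lambda>x. f (x, -1)" 0 "\<delta> - \<mu>"] by simp
  also have "(\<integral>\<^sup>+e. f ((\<delta> + \<mu>) + 1 * e, 1) \<partial>normal 0 \<sigma>) = (\<integral>\<^sup>+x. f (x, 1) \<partial>normal (\<delta> + \<mu>) \<sigma>)"
    using nn_integral_normal_affine[OF assms(1), of 1 "\<lambda>x. f (x, 1)" 0 "\<delta> + \<mu>"] by simp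
  finally show ?thesis .
qed

lemma emeasure_normal_atMost:
  assumes "s > 0"
  shows "emeasure (normal m s) {..c} = ennreal (cdf std_normal_distribution ((c - m) / s))"
    and "emeasure (normal m s) {c<..} = ennreal (cdf std_normal_distribution ((m - c) / s))"
proof -
  interpret S: prob_space std_normal_distribution by (rule prob_space_normal_density) simp
  have ae: "AE x in std_normal_distribution. x \<noteq> a" for a
    by (subst AE_density) (auto intro!: AE_I'[of "{a}"])
  have "emeasure (normal m s) {..c} = (\<integral>\<^sup>+x. indicator {..c} x \<partial>normal m s)" by simp
  also have "\<dots> = (\<integral>\<^sup>+z. indicator {..c} (m + s * z) \<partial>std_normal_distribution)"
    using nn_integral_normal_affine[of 1 s "indicator {..c}" 0 m] assms by simp
  also have "\<dots> = (\<integral>\<^sup>+z. indicator {..(c - m) / s} z \<partial>std_normal_distribution)"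
    using assms by (intro nn_integral_cong) (auto simp: field_simps split: split_indicator)
  also have "\<dots> = ennreal (cdf std_normal_distribution ((c - m) / s))"
    by (simp add: cdf_def S.emeasure_eq_measure)
  finally show "emeasure (normal m s) {..c} = ennreal (cdf std_normal_distribution ((c - m) / s))" .
  have "emeasure (normal m s) {c<..} = (\<integral>\<^sup>+x. indicator {c<..} x \<partial>normal m s)" by simp
  also have "\<dots> = (\<integral>\<^sup>+z. indicator {c<..} (m + (- s) * z) \<partial>std_normal_distribution)"
    using nn_integral_normal_affine[of 1 "-s" "indicator {c<..}" 0 m] assms by simp
  also have "\<dots> = (\<integral>\<^sup>+z. indicator {..(m - c) / s} z \<partial>std_normal_distribution)"
  proof (rule nn_integral_cong_AE, rule AE_mp[OF ae[of "(m - c) / s"]], rule AE_I2, rule impI)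
    fix z assume "z \<noteq> (m - c) / s"
    hence "m + (- s) * z > c \<longleftrightarrow> z \<le> (m - c) / s"
      using assms by (simp add: less_le pos_le_divide_eq pos_less_divide_eq field_simps)
    thus "indicator {c<..} (m + (- s) * z) = (indicator {..(m - c) / s} z :: ennreal)"
      by (simp add: indicator_def)
  qed
  also have "\<dots> = ennreal (cdf std_normal_distribution ((m - c) / s))"
    by (simp add: cdf_def S.emeasure_eq_measure)
  finally show "emeasure (normal m s) {c<..} = ennreal (cdf std_normal_distribution ((m - c) / s))" .
qed

lemma measurable_classify [measurable]:
  "(\<lambda>p. classify (f p) (g p)) \<in> borel_measurable M"
  if [measurable]: "f \<in> borel_measurable M" "g \<in> borel_measurable M"
  unfolding classify_def by measurable

lemma misclassification_target:
  assumes "\<sigma> > 0"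
  shows "emeasure (target \<mu> \<sigma> \<delta>) {p. classify t (fst p) \<noteq> snd p} =
    ennreal (1/2) * emeasure (normal (\<delta> - \<mu>) \<sigma>) {t<..} + ennreal (1/2) * emeasure (normal (\<delta> + \<mu>) \<sigma>) {..t}"
proof -
  have "Measurable.pred (borel \<Otimes>\<^sub>M borel) (\<lambda>p. classify t (fst p) \<noteq> snd p)"
    by measurable
  hence M [measurable]: "{p. classify t (fst p) \<noteq> snd p} \<in> sets (borel \<Otimes>\<^sub>M borel)"
    by (simp add: pred_def space_pair_measure)
  have i1: "indicator {p. classify t (fst p) \<noteq> snd p} (x, -1) = (indicator {t<..} x :: ennreal)"
    and i2: "indicator {p. classify t (fst p) \<noteq> snd p} (x, 1) = (indicator {..t} x :: ennreal)" for x
    by (auto simp: classify_def indicator_def)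
  have "emeasure (target \<mu> \<sigma> \<delta>) {p. classify t (fst p) \<noteq> snd p} =
        (\<integral>\<^sup>+p. indicator {p. classify t (fst p) \<noteq> snd p} p \<partial>target \<mu> \<sigma> \<delta>)"
    using M by (intro nn_integral_indicator[symmetric]) (simp only: sets_target)
  also have "\<dots> = ennreal (1/2) * (\<integral>\<^sup>+x. indicator {t<..} x \<partial>normal (\<delta> - \<mu>) \<sigma>) +
                  ennreal (1/2) * (\<integral>\<^sup>+x. indicator {..t} x \<partial>normal (\<delta> + \<mu>) \<sigma>)"
    by (subst nn_integral_target[OF assms borel_measurable_indicator[OF M]]) (simp only: i1 i2)
  finally show ?thesis by simp
qed

lemma cdf_nonneg': "0 \<le> cdf std_normal_distribution x"
  by (simp add: cdf_def)

lemma ennreal_half_plus: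
  assumes "a \<ge> 0" "b \<ge> 0"
  shows "ennreal (1/2) * ennreal a + ennreal (1/2) * ennreal b = ennreal (1/2 * (b + a))"
proof -
  have "ennreal (1/2 * (b + a)) = ennreal (1/2 * a + 1/2 * b)"
    by (simp add: algebra_simps add_divide_distrib)
  also have "\<dots> = ennreal (1/2 * a) + ennreal (1/2 * b)"
    using assms by (intro ennreal_plus) auto
  also have "\<dots> = ennreal (1/2) * ennreal a + ennreal (1/2) * ennreal b"
    using assms by (intro arg_cong2[of _ _ _ _ "(+)"] ennreal_mult) auto
  finally show ?thesis ..
qed

theorem keep_risk_closed_form:
  assumes "\<sigma> > 0"
  shows "keep_risk \<mu> \<sigma> \<delta> = 1/2 * (cdf std_normal_distribution (- (\<mu> + \<delta>) / \<sigma>)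
                                 + cdf std_normal_distribution ((\<delta> - \<mu>) / \<sigma>))"
proof -
  have "emeasure (target \<mu> \<sigma> \<delta>) {p. classify 0 (fst p) \<noteq> snd p} =
    ennreal (1/2 * (cdf std_normal_distribution (- (\<mu> + \<delta>) / \<sigma>) + cdf std_normal_distribution ((\<delta> - \<mu>) / \<sigma>)))"
    unfolding misclassification_target[OF assms] emeasure_normal_atMost[OF assms]
    by (subst ennreal_half_plus) (auto simp: cdf_nonneg' algebra_simps)
  thus ?thesis
    by (simp add: keep_risk_def measure_def case_prod_unfold cdf_nonneg')
qed

lemma emeasure_normal_halflines:
  assumes "s > 0"
  shows "emeasure (normal m s) {..<c} = ennreal (cdf std_normal_distribution ((c - m) / s))"
    and "emeasure (normal m s) {c..} = ennreal (cdf std_normal_distribution ((m - c) / s))"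
proof -
  have ae: "AE x in normal m s. x \<noteq> c"
    by (subst AE_density) (auto intro!: AE_I'[of "{c}"])
  have "emeasure (normal m s) {..<c} = emeasure (normal m s) {..c}"
    by (rule emeasure_eq_AE, rule AE_mp[OF ae]) auto
  thus "emeasure (normal m s) {..<c} = ennreal (cdf std_normal_distribution ((c - m) / s))"
    by (simp only: emeasure_normal_atMost[OF assms])
  have "emeasure (normal m s) {c..} = emeasure (normal m s) {c<..}"
    by (rule emeasure_eq_AE, rule AE_mp[OF ae]) auto
  thus "emeasure (normal m s) {c..} = ennreal (cdf std_normal_distribution ((m - c) / s))"
    by (simp only: emeasure_normal_atMost[OF assms])
qed

lemma sum_binomial_Suc:
  fixes F :: "nat \<Rightarrow> 'a :: comm_semiring_1"
  shows "(\<Sum>k\<le>Suc n. of_nat (Suc n choose k) * F k) =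
         (\<Sum>k\<le>n. of_nat (n choose k) * F k) + (\<Sum>k\<le>n. of_nat (n choose k) * F (Suc k))"
proof -
  have "(\<Sum>k\<le>Suc n. of_nat (Suc n choose k) * F k) =
        F 0 + (\<Sum>k\<le>n. of_nat (n choose Suc k) * F (Suc k)) + (\<Sum>k\<le>n. of_nat (n choose k) * F (Suc k))"
    by (subst sum.atMost_Suc_shift) (simp add: distrib_right sum.distrib add_ac)
  also have "F 0 + (\<Sum>k\<le>n. of_nat (n choose Suc k) * F (Suc k)) =
             (\<Sum>k\<le>Suc n. of_nat (n choose k) * F k)"
    by (subst sum.atMost_Suc_shift) simp
  also have "\<dots> = (\<Sum>k\<le>n. of_nat (n choose k) * F k)"
    by (simp add: binomial_eq_0)
  finally show ?thesis .
qed

lemma measurable_batch_sum [measurable]: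
  "(\<lambda>w. \<Sum>i<n. fst (w i)) \<in> borel_measurable (\<Pi>\<^sub>M i\<in>{..<n}. target \<mu> \<sigma> \<delta>)"
proof (rule borel_measurable_sum)
  fix i assume i: "i \<in> {..<n}"
  have "(\<lambda>w. w i) \<in> (\<Pi>\<^sub>M i\<in>{..<n}. target \<mu> \<sigma> \<delta>) \<rightarrow>\<^sub>M (borel \<Otimes>\<^sub>M borel)"
    using measurable_component_singleton[OF i, of "\<lambda>_. target \<mu> \<sigma> \<delta>"]
    by (simp cong: measurable_cong_sets add: sets_target)
  from measurable_compose[OF this measurable_fst]
  show "(\<lambda>w. fst (w i)) \<in> borel_measurable (\<Pi>\<^sub>M i\<in>{..<n}. target \<mu> \<sigma> \<delta>)" .
qed

lemma nn_integral_batch_sum: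
  assumes "\<sigma> > 0" "r > 0" and [measurable]: "f \<in> borel_measurable borel"
  shows "(\<integral>\<^sup>+w. \<integral>\<^sup>+e. f ((\<Sum>i<n. fst (w i)) + e) \<partial>normal a r \<partial>(\<Pi>\<^sub>M i\<in>{..<n}. target \<mu> \<sigma> \<delta>)) =
    ennreal (1/2) ^ n * (\<Sum>k\<le>n. of_nat (n choose k) *
      (\<integral>\<^sup>+x. f x \<partial>normal (a + real n * \<delta> + \<mu> * (2 * real k - real n)) (sqrt (r\<^sup>2 + real n * \<sigma>\<^sup>2))))"
  using assms(2,3)
proof (induction n arbitrary: f a r)
  case (0 f a r)
  thus ?case by (simp add: PiM_empty nn_integral_count_space_finite)
next
  case (Suc n f a r)
  note [measurable] = Suc.prems(2)
  interpret T: prob_space "target \<mu> \<sigma> \<delta>" by (rule prob_space_target[OF assms(1)])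
  interpret P: product_sigma_finite "\<lambda>_. target \<mu> \<sigma> \<delta>" by unfold_locales
  interpret R: prob_space "normal a r" using Suc.prems by (intro prob_space_normal_density)
  define g where "g s = (\<integral>\<^sup>+e. f (s + e) \<partial>normal a r)" for s
  have g [measurable]: "g \<in> borel_measurable borel"
    unfolding g_def by measurable
  define r' where "r' = sqrt (r\<^sup>2 + \<sigma>\<^sup>2)"
  have r': "r' > 0" unfolding r'_def using Suc.prems by (simp add: add_pos_nonneg)
  have r'2: "r'\<^sup>2 = r\<^sup>2 + \<sigma>\<^sup>2" unfolding r'_def by simp
  have g_conv: "(\<integral>\<^sup>+x. g (s + x) \<partial>normal b \<sigma>) = (\<integral>\<^sup>+e. f (s + e) \<partial>normal (a + b) r')" for s b
  proof -
    have "(\<integral>\<^sup>+x. g (s + x) \<partial>normal b \<sigma>) = (\<integral>\<^sup>+x. \<integral>\<^sup>+e. f (s + (x + e)) \<partial>normal a r \<partial>normal b \<sigma>)"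
      by (simp add: g_def add.assoc)
    also have "\<dots> = (\<integral>\<^sup>+e. f (s + e) \<partial>normal (b + a) (sqrt (\<sigma>\<^sup>2 + r\<^sup>2)))"
      by (rule nn_integral_normal_conv[OF assms(1) Suc.prems(1)]) measurable
    finally show ?thesis by (simp add: r'_def add.commute)
  qed
  have split: "{..<Suc n} = insert n {..<n}" by auto
  have C: "cdf std_normal_distribution \<in> borel_measurable borel"
    by (rule borel_measurable_mono)
       (auto simp: mono_def cdf_def intro!: finite_measure.finite_measure_mono
             prob_space.finite_measure prob_space_normal_density)
  have meas: "(\<lambda>w. g (\<Sum>i<Suc n. fst (w i))) \<in> borel_measurable (\<Pi>\<^sub>M i\<in>{..<Suc n}. target \<mu> \<sigma> \<delta>)"
    by (rule measurable_compose[OF measurable_batch_sum g])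
  define S where "S w = (\<Sum>i<n. fst (w i))" for w :: "nat \<Rightarrow> real \<times> real"
  have S [measurable]: "S \<in> borel_measurable (\<Pi>\<^sub>M i\<in>{..<n}. target \<mu> \<sigma> \<delta>)"
    unfolding S_def by measurable
  have "(\<integral>\<^sup>+w. g (\<Sum>i<Suc n. fst (w i)) \<partial>(\<Pi>\<^sub>M i\<in>{..<Suc n}. target \<mu> \<sigma> \<delta>)) =
        (\<integral>\<^sup>+w. \<integral>\<^sup>+p. g (S w + fst p) \<partial>target \<mu> \<sigma> \<delta> \<partial>(\<Pi>\<^sub>M i\<in>{..<n}. target \<mu> \<sigma> \<delta>))"
    using meas unfolding split by (subst P.product_nn_integral_insert) (simp_all add: split[symmetric] S_def)
  also have "\<dots> = (\<integral>\<^sup>+w. ennreal (1/2) * (\<integral>\<^sup>+e. f (S w + e) \<partial>normal (a + (\<delta> - \<mu>)) r')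
                       + ennreal (1/2) * (\<integral>\<^sup>+e. f (S w + e) \<partial>normal (a + (\<delta> + \<mu>)) r') \<partial>(\<Pi>\<^sub>M i\<in>{..<n}. target \<mu> \<sigma> \<delta>))"
  proof (rule nn_integral_cong)
    fix w
    show "(\<integral>\<^sup>+p. g (S w + fst p) \<partial>target \<mu> \<sigma> \<delta>) =
      ennreal (1/2) * (\<integral>\<^sup>+e. f (S w + e) \<partial>normal (a + (\<delta> - \<mu>)) r') + ennreal (1/2) * (\<integral>\<^sup>+e. f (S w + e) \<partial>normal (a + (\<delta> + \<mu>)) r')"
      by (subst nn_integral_target[OF assms(1)]) (measurable, simp only: fst_conv g_conv)
  qed
  also have "\<dots> = ennreal (1/2) * (\<integral>\<^sup>+w. \<integral>\<^sup>+e. f (S w + e) \<partial>normal (a + (\<delta> - \<mu>)) r' \<partial>(\<Pi>\<^sub>M i\<in>{..<n}. target \<mu> \<sigma> \<delta>))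
                + ennreal (1/2) * (\<integral>\<^sup>+w. \<integral>\<^sup>+e. f (S w + e) \<partial>normal (a + (\<delta> + \<mu>)) r' \<partial>(\<Pi>\<^sub>M i\<in>{..<n}. target \<mu> \<sigma> \<delta>))"
  proof -
    have [measurable]: "(\<lambda>w. \<integral>\<^sup>+e. f (S w + e) \<partial>normal b r') \<in> borel_measurable (\<Pi>\<^sub>M i\<in>{..<n}. target \<mu> \<sigma> \<delta>)" for b
    proof -
      interpret R': prob_space "normal b r'" using r' by (rule prob_space_normal_density)
      show ?thesis by measurable
    qed
    show ?thesis by (subst nn_integral_add) (simp_all add: nn_integral_cmult)
  qed
  also have "\<dots> = ennreal (1/2) * (ennreal (1/2) ^ n * (\<Sum>k\<le>n. of_nat (n choose k) *
      (\<integral>\<^sup>+x. f x \<partial>normal (a + real (Suc n) * \<delta> + \<mu> * (2 * real k - real (Suc n))) (sqrt (r\<^sup>2 + real (Suc n) * \<sigma>\<^sup>2))))) +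
      ennreal (1/2) * (ennreal (1/2) ^ n * (\<Sum>k\<le>n. of_nat (n choose k) *
      (\<integral>\<^sup>+x. f x \<partial>normal (a + real (Suc n) * \<delta> + \<mu> * (2 * real (Suc k) - real (Suc n))) (sqrt (r\<^sup>2 + real (Suc n) * \<sigma>\<^sup>2)))))"
  proof -
    have e1: "a + (\<delta> - \<mu>) + real n * \<delta> + \<mu> * (2 * real k - real n) =
              a + real (Suc n) * \<delta> + \<mu> * (2 * real k - real (Suc n))" for k
      by (simp add: algebra_simps)
    have e2: "a + (\<delta> + \<mu>) + real n * \<delta> + \<mu> * (2 * real k - real n) =
              a + real (Suc n) * \<delta> + \<mu> * (2 * real (Suc k) - real (Suc n))" for k
      by (simp add: algebra_simps)
    have e3: "r\<^sup>2 + \<sigma>\<^sup>2 + real n * \<sigma>\<^sup>2 = r\<^sup>2 + real (Suc n) * \<sigma>\<^sup>2"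
      by (simp add: algebra_simps)
    show ?thesis
      unfolding S_def Suc.IH[OF r' Suc.prems(2)] r'2 e1 e2 e3 ..
  qed
  also have "\<dots> = ennreal (1/2) ^ Suc n * (\<Sum>k\<le>Suc n. of_nat (Suc n choose k) *
      (\<integral>\<^sup>+x. f x \<partial>normal (a + real (Suc n) * \<delta> + \<mu> * (2 * real k - real (Suc n))) (sqrt (r\<^sup>2 + real (Suc n) * \<sigma>\<^sup>2))))"
    by (simp only: sum_binomial_Suc power_Suc distrib_left mult.assoc)
  finally show ?case unfolding g_def .
qed

theorem recenter_risk_closed_form:
  assumes "\<sigma> > 0" "n \<ge> 1"
  shows "recenter_risk \<mu> \<sigma> \<delta> n = 1 / 2 ^ n * (\<Sum>k\<le>n. real (n choose k) *
    cdf std_normal_distribution ((\<mu> * (2 * real k - real n) / real n - \<mu>) / (\<sigma> * sqrt (1 + 1 / real n))))"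
proof -
  define \<Phi> where "\<Phi> = cdf std_normal_distribution"
  define P where "P = (\<Pi>\<^sub>M i\<in>{..<n}. target \<mu> \<sigma> \<delta>)"
  define A where "A = {q. classify (batch_mean n (fst q)) (fst (snd q)) \<noteq> snd (snd q)}"
  define S where "S w = (\<Sum>i<n. fst (w i))" for w :: "nat \<Rightarrow> real \<times> real"
  define h where "h k = \<Phi> ((\<mu> * (2 * real k - real n) / real n - \<mu>) / (\<sigma> * sqrt (1 + 1 / real n)))" for k
  have n: "real n > 0" using assms by simp
  interpret T: prob_space "target \<mu> \<sigma> \<delta>" by (rule prob_space_target[OF assms(1)])
  interpret PP: product_prob_space "\<lambda>_. target \<mu> \<sigma> \<delta>" by unfold_locales
  interpret P: prob_space P unfolding P_def by (rule prob_space_PiM) unfold_locales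
  have S [measurable]: "S \<in> borel_measurable P"
    unfolding S_def P_def by measurable
  have "Measurable.pred (P \<Otimes>\<^sub>M target \<mu> \<sigma> \<delta>) (\<lambda>q. classify (S (fst q) / real n) (fst (snd q)) \<noteq> snd (snd q))"
    by measurable
  hence A: "A \<inter> space (P \<Otimes>\<^sub>M target \<mu> \<sigma> \<delta>) \<in> sets (P \<Otimes>\<^sub>M target \<mu> \<sigma> \<delta>)"
    by (simp add: pred_def A_def batch_mean_def S_def Int_def conj_commute)
  have sd: "sqrt ((real n * \<sigma>)\<^sup>2 + real n * \<sigma>\<^sup>2) = real n * (\<sigma> * sqrt (1 + 1 / real n))"
  proof (rule real_sqrt_unique)
    show "(real n * (\<sigma> * sqrt (1 + 1 / real n)))\<^sup>2 = (real n * \<sigma>)\<^sup>2 + real n * \<sigma>\<^sup>2"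
      using n by (simp add: power_mult_distrib field_simps power2_eq_square)
  qed (use n assms in auto)
  have sd_pos: "\<sigma> * sqrt (1 + 1 / real n) > 0"
    using n assms by (simp add: add_pos_pos)
  have affine: "emeasure (normal m \<sigma>) {x. s / real n < x} =
      (\<integral>\<^sup>+e. indicator {..<0} (s + e) \<partial>normal (- (real n * m)) (real n * \<sigma>))"
    "emeasure (normal m \<sigma>) {x. x \<le> s / real n} =
      (\<integral>\<^sup>+e. indicator {0..} (s + e) \<partial>normal (- (real n * m)) (real n * \<sigma>))" for m s
  proof -
    have *: "(\<integral>\<^sup>+e. indicator B (s + e) \<partial>normal (- (real n * m)) (real n * \<sigma>)) =
        (\<integral>\<^sup>+x. indicator B (s + (0 + (- real n) * x)) \<partial>normal m \<sigma>)" if [measurable]: "B \<in> sets borel" for B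
      using n assms(1) by (subst nn_integral_normal_affine) simp_all
    have i1: "indicator {..<0} (s + (0 + - real n * x)) = (indicator {s / real n<..} x :: ennreal)"
      and i2: "indicator {0..} (s + (0 + - real n * x)) = (indicator {..s / real n} x :: ennreal)" for x
      using n by (auto simp: indicator_def field_simps)
    have "emeasure (normal m \<sigma>) {s / real n<..} = (\<integral>\<^sup>+x. indicator {s / real n<..} x \<partial>normal m \<sigma>)" by simp
    also have "\<dots> = (\<integral>\<^sup>+e. indicator {..<0} (s + e) \<partial>normal (- (real n * m)) (real n * \<sigma>))"
      using i1 by (subst *) (simp_all only: borel_open open_lessThan)
    finally show "emeasure (normal m \<sigma>) {x. s / real n < x} =
      (\<integral>\<^sup>+e. indicator {..<0} (s + e) \<partial>normal (- (real n * m)) (real n * \<sigma>))"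
      by (simp add: greaterThan_def)
    have "emeasure (normal m \<sigma>) {..s / real n} = (\<integral>\<^sup>+x. indicator {..s / real n} x \<partial>normal m \<sigma>)" by simp
    also have "\<dots> = (\<integral>\<^sup>+e. indicator {0..} (s + e) \<partial>normal (- (real n * m)) (real n * \<sigma>))"
      using i2 by (subst *) (simp_all only: borel_closed closed_atLeast)
    finally show "emeasure (normal m \<sigma>) {x. x \<le> s / real n} =
      (\<integral>\<^sup>+e. indicator {0..} (s + e) \<partial>normal (- (real n * m)) (real n * \<sigma>))"
      by (simp add: atMost_def)
  qed
  have mix1: "(\<integral>\<^sup>+w. emeasure (normal (\<delta> - \<mu>) \<sigma>) {S w / real n<..} \<partial>P) =
      ennreal (1/2) ^ n * (\<Sum>k\<le>n. of_nat (n choose k) * ennreal (h (n - k)))"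
  proof -
    have "(\<integral>\<^sup>+w. emeasure (normal (\<delta> - \<mu>) \<sigma>) {S w / real n<..} \<partial>P) =
      ennreal (1/2) ^ n * (\<Sum>k\<le>n. of_nat (n choose k) *
       emeasure (normal (- (real n * (\<delta> - \<mu>)) + real n * \<delta> + \<mu> * (2 * real k - real n)) (real n * (\<sigma> * sqrt (1 + 1 / real n)))) {..<0})"
      unfolding greaterThan_def affine(1) S_def P_def
      using n assms(1) by (subst nn_integral_batch_sum) (simp_all add: sd)
    note calc = this
    have E: "emeasure (normal (- (real n * (\<delta> - \<mu>)) + real n * \<delta> + \<mu> * (2 * real k - real n)) (real n * (\<sigma> * sqrt (1 + 1 / real n)))) {..<0}
        = ennreal (h (n - k))" if "k \<le> n" for k
    proof -
      have "(0 - (- (real n * (\<delta> - \<mu>)) + real n * \<delta> + \<mu> * (2 * real k - real n))) / (real n * (\<sigma> * sqrt (1 + 1 / real n)))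
        = (\<mu> * (2 * real (n - k) - real n) / real n - \<mu>) / (\<sigma> * sqrt (1 + 1 / real n))"
        unfolding divide_divide_eq_left[symmetric] using n that
        by (intro arg_cong2[of _ _ _ _ "(/)"] refl) (simp add: of_nat_diff field_simps)
      thus ?thesis using n sd_pos by (subst emeasure_normal_halflines(1)) (simp_all add: h_def \<Phi>_def)
    qed
    show ?thesis unfolding calc
      by (intro arg_cong2[of _ _ _ _ "(*)"] sum.cong refl) (simp only: E atMost_iff)
  qed
  have mix2: "(\<integral>\<^sup>+w. emeasure (normal (\<delta> + \<mu>) \<sigma>) {..S w / real n} \<partial>P) =
      ennreal (1/2) ^ n * (\<Sum>k\<le>n. of_nat (n choose k) * ennreal (h k))"
  proof -
    have "(\<integral>\<^sup>+w. emeasure (normal (\<delta> + \<mu>) \<sigma>) {..S w / real n} \<partial>P) =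
      ennreal (1/2) ^ n * (\<Sum>k\<le>n. of_nat (n choose k) *
       emeasure (normal (- (real n * (\<delta> + \<mu>)) + real n * \<delta> + \<mu> * (2 * real k - real n)) (real n * (\<sigma> * sqrt (1 + 1 / real n)))) {0..})"
      unfolding atMost_def affine(2) S_def P_def
      using n assms(1) by (subst nn_integral_batch_sum) (simp_all add: sd atMost_def)
    note calc = this
    have E: "emeasure (normal (- (real n * (\<delta> + \<mu>)) + real n * \<delta> + \<mu> * (2 * real k - real n)) (real n * (\<sigma> * sqrt (1 + 1 / real n)))) {0..}
        = ennreal (h k)" for k
    proof -
      have "((- (real n * (\<delta> + \<mu>)) + real n * \<delta> + \<mu> * (2 * real k - real n)) - 0) / (real n * (\<sigma> * sqrt (1 + 1 / real n)))
        = (\<mu> * (2 * real k - real n) / real n - \<mu>) / (\<sigma> * sqrt (1 + 1 / real n))"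
        unfolding divide_divide_eq_left[symmetric] using n
        by (intro arg_cong2[of _ _ _ _ "(/)"] refl) (simp add: field_simps)
      thus ?thesis using n sd_pos by (subst emeasure_normal_halflines(2)) (simp_all add: h_def \<Phi>_def)
    qed
    show ?thesis unfolding calc
      by (intro arg_cong2[of _ _ _ _ "(*)"] sum.cong refl) (simp only: E atMost_iff)
  qed
  have rev: "(\<Sum>k\<le>n. of_nat (n choose k) * ennreal (h (n - k))) = (\<Sum>k\<le>n. of_nat (n choose k) * ennreal (h k))"
    by (rule sum.reindex_bij_witness[of _ "\<lambda>k. n - k" "\<lambda>k. n - k"]) (auto simp: binomial_symmetric[symmetric])
  have C: "cdf std_normal_distribution \<in> borel_measurable borel"
    by (rule borel_measurable_mono)
       (auto simp: mono_def cdf_def intro!: finite_measure.finite_measure_mono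
             prob_space.finite_measure prob_space_normal_density)
  have meas: "(\<lambda>w. emeasure (normal m \<sigma>) {S w / real n<..}) \<in> borel_measurable P"
             "(\<lambda>w. emeasure (normal m \<sigma>) {..S w / real n}) \<in> borel_measurable P" for m
    unfolding emeasure_normal_atMost[OF assms(1)]
    by (intro measurable_compose[OF _ measurable_ennreal] measurable_compose[OF _ C]
          borel_measurable_divide borel_measurable_diff borel_measurable_const S)+
  have "emeasure (P \<Otimes>\<^sub>M target \<mu> \<sigma> \<delta>) (A \<inter> space (P \<Otimes>\<^sub>M target \<mu> \<sigma> \<delta>)) =
     (\<integral>\<^sup>+w. emeasure (target \<mu> \<sigma> \<delta>) (Pair w -` (A \<inter> space (P \<Otimes>\<^sub>M target \<mu> \<sigma> \<delta>))) \<partial>P)"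
    by (rule T.emeasure_pair_measure_alt[OF A])
  also have "\<dots> = (\<integral>\<^sup>+w. ennreal (1/2) * emeasure (normal (\<delta> - \<mu>) \<sigma>) {S w / real n<..} +
                        ennreal (1/2) * emeasure (normal (\<delta> + \<mu>) \<sigma>) {..S w / real n} \<partial>P)"
  proof (rule nn_integral_cong)
    fix w assume "w \<in> space P"
    hence "Pair w -` (A \<inter> space (P \<Otimes>\<^sub>M target \<mu> \<sigma> \<delta>)) = {p. classify (S w / real n) (fst p) \<noteq> snd p}"
      by (auto simp: A_def batch_mean_def S_def space_pair_measure)
    thus "emeasure (target \<mu> \<sigma> \<delta>) (Pair w -` (A \<inter> space (P \<Otimes>\<^sub>M target \<mu> \<sigma> \<delta>))) =
      ennreal (1/2) * emeasure (normal (\<delta> - \<mu>) \<sigma>) {S w / real n<..} +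
      ennreal (1/2) * emeasure (normal (\<delta> + \<mu>) \<sigma>) {..S w / real n}"
      by (simp only: misclassification_target[OF assms(1)])
  qed
  also have "\<dots> = ennreal (1/2) * (\<integral>\<^sup>+w. emeasure (normal (\<delta> - \<mu>) \<sigma>) {S w / real n<..} \<partial>P) +
                  ennreal (1/2) * (\<integral>\<^sup>+w. emeasure (normal (\<delta> + \<mu>) \<sigma>) {..S w / real n} \<partial>P)"
    using meas by (subst nn_integral_add) (simp_all add: nn_integral_cmult)
  also have "\<dots> = (ennreal (1/2) + ennreal (1/2)) * (ennreal (1/2) ^ n * (\<Sum>k\<le>n. of_nat (n choose k) * ennreal (h k)))"
    unfolding mix1 mix2 rev by (simp only: distrib_right)
  also have "ennreal (1/2) + ennreal (1/2) = 1"
    by (subst ennreal_plus[symmetric]) simp_all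
  also have "1 * (ennreal (1/2) ^ n * (\<Sum>k\<le>n. of_nat (n choose k) * ennreal (h k))) =
             ennreal ((1/2) ^ n * (\<Sum>k\<le>n. real (n choose k) * h k))"
  proof -
    have h0: "h k \<ge> 0" for k by (simp add: h_def \<Phi>_def cdf_nonneg')
    have "ennreal ((1/2) ^ n * (\<Sum>k\<le>n. real (n choose k) * h k)) =
          ennreal ((1/2) ^ n) * ennreal (\<Sum>k\<le>n. real (n choose k) * h k)"
      by (intro ennreal_mult sum_nonneg mult_nonneg_nonneg h0) auto
    also have "ennreal (\<Sum>k\<le>n. real (n choose k) * h k) = (\<Sum>k\<le>n. ennreal (real (n choose k) * h k))"
      by (intro sum_ennreal[symmetric] mult_nonneg_nonneg h0) auto
    also have "\<dots> = (\<Sum>k\<le>n. of_nat (n choose k) * ennreal (h k))"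
      by (intro sum.cong refl) (simp add: ennreal_mult h0 ennreal_of_nat_eq_real_of_nat)
    also have "ennreal ((1/2) ^ n) = ennreal (1/2) ^ n"
      by (intro ennreal_power[symmetric]) simp
    finally show ?thesis by simp
  qed
  finally have "emeasure (P \<Otimes>\<^sub>M target \<mu> \<sigma> \<delta>) (A \<inter> space (P \<Otimes>\<^sub>M target \<mu> \<sigma> \<delta>)) =
             ennreal ((1/2) ^ n * (\<Sum>k\<le>n. real (n choose k) * h k))" .
  moreover have "recenter_risk \<mu> \<sigma> \<delta> n = measure (P \<Otimes>\<^sub>M target \<mu> \<sigma> \<delta>) (A \<inter> space (P \<Otimes>\<^sub>M target \<mu> \<sigma> \<delta>))"
    unfolding recenter_risk_def P_def[symmetric] A_def
    by (intro arg_cong2[of _ _ _ _ measure]) auto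
  moreover have "(1/2) ^ n * (\<Sum>k\<le>n. real (n choose k) * h k) \<ge> 0"
    by (intro mult_nonneg_nonneg sum_nonneg) (simp_all add: h_def \<Phi>_def cdf_nonneg')
  ultimately show ?thesis
    by (simp add: measure_def h_def \<Phi>_def power_one_over)
qed

corollary recenter_risk_shift_invariant:
  assumes "\<sigma> > 0" "n \<ge> 1"
  shows "recenter_risk \<mu> \<sigma> \<delta> n = recenter_risk \<mu> \<sigma> \<delta>' n"
  using assms by (simp only: recenter_risk_closed_form)

end

theory Submission
  imports Defs "HOL-Real_Asymp.Real_Asymp"
begin

text \<open>
  Put \<open>a = \<mu> / \<sigma>\<close>, \<open>K\<^sub>b v = (\<Phi> (v - b) + \<Phi> (- v - b)) / 2\<close> and \<open>b = a / sqrt (1 + 1 / n)\<close>. KEEP has risk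
  \<open>K\<^sub>a (\<delta> / \<sigma>)\<close>, and since the binomial weights are symmetric, RECENTER has risk \<open>E[K\<^sub>b (b S)]\<close>, where \<open>S\<close>
  is the mean of \<open>n\<close> independent signs. As \<open>K\<^sub>b\<close> is even and increases strictly on \<open>[0, \<infinity>)\<close> from
  \<open>\<Phi> (- b) > \<Phi> (- a)\<close> to \<open>1 / 2\<close>, the RECENTER risk lies strictly between \<open>K\<^sub>a 0\<close> and the limit of \<open>K\<^sub>a\<close>,
  which gives the critical shift. Taylor expansion of \<open>K\<^sub>b\<close> to fourth order, with \<open>E[S\<^sup>2] = 1 / n\<close>,
  \<open>E[S\<^sup>4] \<le> 3 / n\<^sup>2\<close> and \<open>a - b = a / (2 n) + O(n\<^sup>-\<^sup>2)\<close>, shows that the RECENTER risk and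
  \<open>K\<^sub>a (sqrt ((a\<^sup>2 + 1) / n))\<close> are both \<open>\<Phi> (- a) + a (1 + a\<^sup>2) \<Phi>' a / (2 n) + O(n\<^sup>-\<^sup>2)\<close>. As \<open>K\<^sub>a\<close> grows
  at least like a multiple of \<open>v\<^sup>2\<close> on \<open>[0, 1]\<close>, the squares of the two arguments differ by
  \<open>O(n\<^sup>-\<^sup>2)\<close>, hence the arguments themselves by \<open>O(n\<^sup>-\<^sup>3\<^sup>/\<^sup>2)\<close>.
\<close>

section \<open>The standard normal distribution function\<close>

abbreviation Phi :: "real \<Rightarrow> real" where
  "Phi \<equiv> cdf std_normal_distribution"

interpretation std_normal: real_distribution std_normal_distribution
  by (rule real_dist_normal_dist)

text \<open>On the open half-line right of \<open>x - 1\<close>, \<open>Phi\<close> is a constant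
  plus the integral of the density from \<open>x - 1\<close>. Starting the integral left of
  \<open>x\<close> makes \<open>x\<close> an interior point, so the fundamental theorem of calculus
  yields a two-sided derivative.\<close>

lemma DERIV_Phi: "(Phi has_real_derivative std_normal_density x) (at x)"
proof -
  have cont: "continuous_on S std_normal_density" for S
    unfolding std_normal_density_def by (intro continuous_intros) auto
  have Phi_eq: "Phi t = Phi (x - 1) + integral {x - 1..t} std_normal_density" if t: "x - 1 < t" for t
  proof -
    have si: "set_integrable lborel {x - 1..t} std_normal_density"
      by (intro borel_integrable_atLeastAtMost' cont)
    have "Phi t - Phi (x - 1) = measure std_normal_distribution {x - 1<..t}"
      using t by (rule std_normal.cdf_diff_eq)
    also have "\<dots> = (LINT y|std_normal_distribution. indicator {x - 1<..t} y)"
      by simp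
    also have "\<dots> = (LBINT y:{x - 1<..t}. std_normal_density y)"
      unfolding set_lebesgue_integral_def
      by (subst integral_density) (auto simp: mult.commute)
    also have "\<dots> = (LBINT y=x - 1..t. std_normal_density y)"
      using t by (simp add: interval_integral_Ioc)
    also have "\<dots> = integral {x - 1..t} std_normal_density"
      using t si by (intro interval_integral_eq_integral) auto
    finally show ?thesis by simp
  qed
  have "((\<lambda>t. integral {x - 1..t} std_normal_density) has_real_derivative std_normal_density x)
      (at x within {x - 1..x + 1})"
    by (rule integral_has_real_derivative[OF cont]) auto
  hence "((\<lambda>t. integral {x - 1..t} std_normal_density) has_real_derivative std_normal_density x) (at x)"
    by (subst (asm) at_within_Icc_at) auto
  hence "((\<lambda>t. Phi (x - 1) + integral {x - 1..t} std_normal_density)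
      has_real_derivative std_normal_density x) (at x)"
    by (auto intro!: derivative_eq_intros)
  thus ?thesis
  proof (rule has_field_derivative_transform_within_open)
    show "open {x - 1<..}" "x \<in> {x - 1<..}" by auto
  qed (simp add: Phi_eq)
qed

lemmas DERIV_Phi' [derivative_intros] = DERIV_chain2[OF DERIV_Phi]

lemma DERIV_std_normal_density:
  "(std_normal_density has_real_derivative - x * std_normal_density x) (at x)"
  unfolding std_normal_density_def
  by (rule derivative_eq_intros refl | simp add: field_simps)+

lemmas DERIV_std_normal_density' [derivative_intros] = DERIV_chain2[OF DERIV_std_normal_density]

lemma std_normal_density_le_1: "std_normal_density x \<le> 1"
proof -
  have "1 \<le> sqrt (2 * pi)" using pi_gt3 by simp
  thus ?thesis unfolding std_normal_density_def
    by (intro mult_le_one) auto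
qed

lemma std_normal_density_minus [simp]: "std_normal_density (- x) = std_normal_density x"
  by (simp add: std_normal_density_def)

lemma strict_mono_Phi: "x < y \<Longrightarrow> Phi x < Phi y"
  by (rule DERIV_pos_imp_increasing) (auto intro!: exI DERIV_Phi normal_density_pos)

text \<open>The upper tail beyond \<open>- x\<close> has mass \<open>Phi x\<close> by reflection,
  and it is also the complement of the half-line up to \<open>- x\<close>.\<close>

lemma Phi_minus: "Phi (- x) = 1 - Phi x"
proof -
  have "ennreal (Phi x) = ennreal (1 - Phi (- x))"
  proof -
    have "emeasure std_normal_distribution {-x<..} = ennreal (Phi x)"
      using emeasure_normal_atMost(2)[of 1 0 "- x"] by simp
    moreover have "emeasure std_normal_distribution {-x<..} =
        ennreal (measure std_normal_distribution (space std_normal_distribution - {..-x}))"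
      by (subst std_normal.emeasure_eq_measure) (auto intro!: arg_cong[where f = "measure _"])
    moreover have "measure std_normal_distribution (space std_normal_distribution - {..-x}) = 1 - Phi (-x)"
      by (subst std_normal.prob_compl) (auto simp: cdf_def)
    ultimately show ?thesis by simp
  qed
  \<comment> \<open>Both arguments of \<open>ennreal\<close> are nonnegative, so the equation
    descends to the reals.\<close>
  thus ?thesis using std_normal.cdf_bounded_prob[of "- x"] cdf_nonneg'[of x] by simp
qed

section \<open>The KEEP risk in units of the noise level\<close>

definition keep_profile :: "real \<Rightarrow> real \<Rightarrow> real" where
  "keep_profile b v = (Phi (v - b) + Phi (- v - b)) / 2"

lemma keep_profile_minus [simp]: "keep_profile b (- v) = keep_profile b v"
  by (simp add: keep_profile_def add.commute)

lemma keep_profile_abs [simp]: "keep_profile b \<bar>v\<bar> = keep_profile b v"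
  by (simp add: abs_if)

lemma keep_profile_0 [simp]: "keep_profile b 0 = Phi (- b)"
  by (simp add: keep_profile_def)

lemma DERIV_keep_profile:
  "(keep_profile b has_real_derivative (std_normal_density (v - b) - std_normal_density (v + b)) / 2) (at v)"
proof -
  have "std_normal_density (- v - b) = std_normal_density (v + b)"
    using std_normal_density_minus[of "v + b"] by (simp del: std_normal_density_minus)
  thus ?thesis unfolding keep_profile_def
    by (auto intro!: derivative_eq_intros)
qed

text \<open>Completing the squares pulls out a positive Gaussian factor and leaves twice the
  hyperbolic sine of \<open>b * v\<close>. This form shows the sign of the derivative and can also
  be bounded below linearly in \<open>v\<close>.\<close>

lemma keep_profile_deriv_eq:
  "std_normal_density (v - b) - std_normal_density (v + b) =
     std_normal_density b * exp (- v\<^sup>2 / 2) * (exp (b * v) - exp (- (b * v)))"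
proof -
  have "exp (- (v - b)\<^sup>2 / 2) = exp (- b\<^sup>2 / 2) * exp (- v\<^sup>2 / 2) * exp (b * v)"
    and "exp (- (v + b)\<^sup>2 / 2) = exp (- b\<^sup>2 / 2) * exp (- v\<^sup>2 / 2) * exp (- (b * v))"
    by (simp_all add: power2_eq_square field_simps flip: exp_add)
  thus ?thesis unfolding std_normal_density_def by (simp only:) (simp add: left_diff_distrib right_diff_distrib diff_divide_distrib mult_ac)
qed

lemma keep_profile_strict_mono:
  assumes "b > 0" "0 \<le> u" "u < v"
  shows "keep_profile b u < keep_profile b v"
proof (rule DERIV_pos_imp_increasing_open[OF assms(3)])
  fix x assume "u < x" "x < v"
  hence "b * x > 0" using assms by simp
  hence "(std_normal_density (x - b) - std_normal_density (x + b)) / 2 > 0"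
    unfolding keep_profile_deriv_eq by (simp add: normal_density_pos)
  thus "\<exists>y. DERIV (keep_profile b) x :> y \<and> y > 0" using DERIV_keep_profile by blast
qed (rule DERIV_continuous_on, rule has_field_derivative_at_within, rule DERIV_keep_profile)

text \<open>Evenness replaces both arguments by their absolute values, where strict monotonicity
  decides the comparison; in the remaining case it gives the opposite weak inequality.\<close>

lemma keep_profile_less_iff:
  assumes "b > 0"
  shows "keep_profile b u < keep_profile b v \<longleftrightarrow> \<bar>u\<bar> < \<bar>v\<bar>"
proof (cases "\<bar>u\<bar> < \<bar>v\<bar>")
  case True
  thus ?thesis using keep_profile_strict_mono[OF assms, of "\<bar>u\<bar>" "\<bar>v\<bar>"] by simp
next
  case False
  hence "\<bar>v\<bar> < \<bar>u\<bar> \<or> \<bar>v\<bar> = \<bar>u\<bar>" by linarith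
  hence "keep_profile b \<bar>v\<bar> \<le> keep_profile b \<bar>u\<bar>"
    using keep_profile_strict_mono[OF assms, of "\<bar>v\<bar>" "\<bar>u\<bar>"]
    by (elim disjE) (auto simp del: keep_profile_abs)
  thus ?thesis using False by simp
qed

text \<open>Moving both arguments left by \<open>b\<close> strictly lowers each term, while
  \<open>Phi v + Phi (- v) = 1\<close>.\<close>

lemma keep_profile_less_half: "b > 0 \<Longrightarrow> keep_profile b v < 1 / 2"
  using strict_mono_Phi[of "v - b" v] strict_mono_Phi[of "- v - b" "- v"] Phi_minus[of v]
  by (simp add: keep_profile_def)

lemma keep_profile_at_top: "(keep_profile b \<longlongrightarrow> 1 / 2) at_top"
proof -
  have "((\<lambda>v. Phi (v - b)) \<longlongrightarrow> 1) at_top"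
    by (rule filterlim_compose[OF std_normal.cdf_lim_at_top_prob]) real_asymp
  moreover have "((\<lambda>v. Phi (- v - b)) \<longlongrightarrow> 0) at_top"
    by (rule filterlim_compose[OF std_normal.cdf_lim_at_bot]) real_asymp
  ultimately have "((\<lambda>v. (Phi (v - b) + Phi (- v - b)) / 2) \<longlongrightarrow> (1 + 0) / 2) at_top"
    by (intro tendsto_intros) auto
  thus ?thesis
    by (simp add: keep_profile_def[abs_def])
qed

text \<open>This converts closeness of risks into closeness of squared shifts: subtracting a
  suitable multiple of \<open>v\<^sup>2\<close> from the profile leaves a nondecreasing function on
  \<open>[0, 1]\<close>.\<close>

lemma keep_profile_diff_ge:
  assumes b: "b > 0" and uv: "0 \<le> u" "u \<le> v" "v \<le> 1"
  shows "std_normal_density b * exp (- 1 / 2) * b / 4 * (v\<^sup>2 - u\<^sup>2) \<le> keep_profile b v - keep_profile b u"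
proof -
  \<comment> \<open>The constant makes \<open>2 * c * x\<close> equal to the lower bound for the
    derivative obtained from \<open>exp (b * x) \<ge> 1 + b * x\<close>,
    \<open>exp (- (b * x)) \<le> 1\<close> and \<open>x \<le> 1\<close>.\<close>
  define c where "c = std_normal_density b * exp (- 1 / 2) * b / 4"
  have "keep_profile b u - c * u\<^sup>2 \<le> keep_profile b v - c * v\<^sup>2"
  proof (rule DERIV_nonneg_imp_nondecreasing[OF uv(2)], intro exI conjI)
    fix x assume x: "u \<le> x" "x \<le> v"
    show "((\<lambda>x. keep_profile b x - c * x\<^sup>2) has_real_derivative
        (std_normal_density (x - b) - std_normal_density (x + b)) / 2 - c * (2 * x)) (at x)"
      by (auto intro!: derivative_eq_intros DERIV_keep_profile)
    have x01: "0 \<le> x" "x \<le> 1" using x uv by auto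
    have "b * x \<le> exp (b * x) - exp (- (b * x))"
      using exp_ge_add_one_self[of "b * x"] x01 b by (smt (verit) exp_le_one_iff mult_nonneg_nonneg)
    moreover have "exp (- 1 / 2) \<le> exp (- x\<^sup>2 / 2)"
      using x01 by (simp add: power_le_one)
    ultimately have "std_normal_density b * exp (- 1 / 2) * (b * x)
        \<le> std_normal_density b * exp (- x\<^sup>2 / 2) * (exp (b * x) - exp (- (b * x)))"
      using x01 b by (intro mult_mono) auto
    thus "0 \<le> (std_normal_density (x - b) - std_normal_density (x + b)) / 2 - c * (2 * x)"
      unfolding keep_profile_deriv_eq c_def by (simp add: algebra_simps)
  qed
  thus ?thesis unfolding c_def [symmetric] by (simp add: right_diff_distrib)
qed

section \<open>Taylor expansions, moments of sign sums, and the crossing point\<close>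

fun Phi_deriv :: "nat \<Rightarrow> real \<Rightarrow> real" where
  "Phi_deriv 0 x = Phi x"
| "Phi_deriv (Suc 0) x = std_normal_density x"
| "Phi_deriv (Suc (Suc 0)) x = - x * std_normal_density x"
| "Phi_deriv (Suc (Suc (Suc 0))) x = (x\<^sup>2 - 1) * std_normal_density x"
| "Phi_deriv (Suc (Suc (Suc (Suc _)))) x = (3 * x - x ^ 3) * std_normal_density x"

text \<open>The family has the indexed form that Maclaurin's theorem expects. From order 4 on it
  repeats the fourth derivative as a default value, hence the bound on \<open>m\<close>; order 4 is
  the highest remainder used.\<close>

lemma DERIV_Phi_deriv:
  assumes "m < 4"
  shows "(Phi_deriv m has_real_derivative Phi_deriv (Suc m) x) (at x)"
proof -
  have eqs: "Phi_deriv 0 = Phi" "Phi_deriv 1 = std_normal_density"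
    "Phi_deriv 2 = (\<lambda>x. - x * std_normal_density x)"
    "Phi_deriv 3 = (\<lambda>x. (x\<^sup>2 - 1) * std_normal_density x)"
    by (auto simp: numeral_eq_Suc)
  consider "m = 0" | "m = 1" | "m = 2" | "m = 3" using assms by linarith
  thus ?thesis
  proof cases
    case 1
    thus ?thesis using DERIV_Phi by (simp add: eqs)
  next
    case 2
    thus ?thesis using DERIV_std_normal_density by (simp add: eqs(2)[unfolded One_nat_def])
  next
    case 3
    have "((\<lambda>x. - x * std_normal_density x) has_real_derivative (x\<^sup>2 - 1) * std_normal_density x) (at x)"
      by (rule derivative_eq_intros refl)+ (simp add: algebra_simps power2_eq_square)
    thus ?thesis using 3 eqs by (simp add: numeral_eq_Suc)
  next
    case 4
    have "((\<lambda>x. (x\<^sup>2 - 1) * std_normal_density x) has_real_derivative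
        (3 * x - x ^ 3) * std_normal_density x) (at x)"
      by (rule derivative_eq_intros refl)+ (simp add: algebra_simps power2_eq_square power3_eq_cube)
    thus ?thesis using 4 eqs by (simp add: numeral_eq_Suc)
  qed
qed

lemmas DERIV_Phi_deriv' [derivative_intros] = DERIV_chain2[OF DERIV_Phi_deriv]

text \<open>Taylor's formula for \<open>Phi (h - a)\<close> around \<open>h = 0\<close>, taken at
  \<open>h = a - b\<close> with a second-order Lagrange remainder.\<close>

lemma Phi_expansion:
  assumes "0 \<le> b" "b \<le> a"
  shows "\<bar>Phi (- b) - (Phi (- a) + std_normal_density a * (a - b))\<bar> \<le> a * (a - b)\<^sup>2"
proof -
  define f where "f m h = Phi_deriv m (h - a)" for m h
  have "\<exists>t. \<bar>t\<bar> \<le> \<bar>a - b\<bar> \<and> f 0 (a - b) = (\<Sum>m<2. f m 0 / fact m * (a - b) ^ m) + f 2 t / fact 2 * (a - b)\<^sup>2"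
    unfolding f_def
    by (intro Maclaurin_bi_le refl allI impI)
       (rule derivative_eq_intros refl | simp)+
  then obtain t where t: "\<bar>t\<bar> \<le> \<bar>a - b\<bar>"
    and eq: "f 0 (a - b) = (\<Sum>m<2. f m 0 / fact m * (a - b) ^ m) + f 2 t / fact 2 * (a - b)\<^sup>2"
    by blast
  have "Phi (- b) - (Phi (- a) + std_normal_density a * (a - b)) = f 2 t / 2 * (a - b)\<^sup>2"
    using eq by (simp add: f_def numeral_2_eq_2)
  \<comment> \<open>The remainder is evaluated at \<open>t - a\<close>, and
    \<open>\<bar>t\<bar> \<le> a - b \<le> a\<close> gives
    \<open>\<bar>t - a\<bar> \<le> 2 * a\<close>.\<close>
  moreover have "\<bar>f 2 t\<bar> \<le> (2 * a) * 1"
    unfolding f_def numeral_2_eq_2 Phi_deriv.simps abs_mult using t assms std_normal_density_le_1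
    by (intro mult_mono) auto
  hence "\<bar>f 2 t / 2\<bar> \<le> a" by simp
  ultimately show ?thesis
    by (simp only: abs_mult abs_power2) (intro mult_right_mono, auto)
qed

text \<open>Evenness in \<open>v\<close> kills the odd terms, and the second derivative at 0 is
  \<open>b * std_normal_density b\<close>. The fourth-order remainder is evaluated at points of
  modulus at most \<open>B\<close>, so its bound is uniform in \<open>b\<close> as well as
  \<open>v\<close>.\<close>

lemma keep_profile_expansion:
  assumes "\<bar>b\<bar> + \<bar>v\<bar> \<le> B"
  shows "\<bar>keep_profile b v - (Phi (- b) + b * std_normal_density b / 2 * v\<^sup>2)\<bar> \<le> (3 * B + B ^ 3) * v ^ 4"
proof -
  \<comment> \<open>The sign \<open>(- 1) ^ m\<close> comes from differentiating the reflected term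
    \<open>m\<close> times.\<close>
  define f where "f m h = (Phi_deriv m (h - b) + (- 1) ^ m * Phi_deriv m (- h - b)) / 2" for m h
  have "\<exists>t. \<bar>t\<bar> \<le> \<bar>v\<bar> \<and> f 0 v = (\<Sum>m<4. f m 0 / fact m * v ^ m) + f 4 t / fact 4 * v ^ 4"
    unfolding f_def
    by (intro Maclaurin_bi_le refl allI impI)
       (rule derivative_eq_intros refl | simp)+
  then obtain t where t: "\<bar>t\<bar> \<le> \<bar>v\<bar>"
    and eq: "f 0 v = (\<Sum>m<4. f m 0 / fact m * v ^ m) + f 4 t / fact 4 * v ^ 4"
    by blast
  have bd: "\<bar>Phi_deriv 4 x\<bar> \<le> 3 * B + B ^ 3" if "\<bar>x\<bar> \<le> B" for x
  proof -
    have "\<bar>3 * x - x ^ 3\<bar> \<le> 3 * \<bar>x\<bar> + \<bar>x\<bar> ^ 3"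
      by (metis abs_triangle_ineq4 abs_mult abs_numeral power_abs)
    also have "\<dots> \<le> 3 * B + B ^ 3"
      using that by (intro add_mono mult_left_mono power_mono) auto
    finally have "\<bar>3 * x - x ^ 3\<bar> * std_normal_density x \<le> (3 * B + B ^ 3) * 1"
      using std_normal_density_le_1 that by (intro mult_mono) auto
    thus ?thesis by (simp add: numeral_eq_Suc abs_mult)
  qed
  have eq2: "keep_profile b v - (Phi (- b) + b * std_normal_density b / 2 * v\<^sup>2) = f 4 t / 24 * v ^ 4"
  proof -
    have "f 0 v = keep_profile b v"
      by (simp add: f_def keep_profile_def)
    moreover have "(\<Sum>m<4. f m 0 / fact m * v ^ m) = Phi (- b) + b * std_normal_density b / 2 * v\<^sup>2"
      by (simp add: f_def eval_nat_numeral)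
    moreover have "fact 4 = (24 :: real)"
      by (simp add: fact_numeral)
    ultimately show ?thesis using eq by simp
  qed
  have "\<bar>f 4 t\<bar> \<le> 3 * B + B ^ 3"
  proof -
    have "\<bar>Phi_deriv 4 (t - b)\<bar> \<le> 3 * B + B ^ 3" "\<bar>Phi_deriv 4 (- t - b)\<bar> \<le> 3 * B + B ^ 3"
      using t assms by (intro bd; linarith)+
    thus ?thesis by (simp add: f_def)
  qed
  hence bd2: "\<bar>f 4 t / 24\<bar> \<le> 3 * B + B ^ 3" by simp
  have "\<bar>f 4 t / 24 * v ^ 4\<bar> = \<bar>f 4 t / 24\<bar> * v ^ 4"
    by (simp add: abs_mult)
  also have "\<dots> \<le> (3 * B + B ^ 3) * v ^ 4"
    using bd2 by (rule mult_right_mono) simp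
  finally show ?thesis unfolding eq2 .
qed

text \<open>With \<open>k\<close> plus signs among \<open>n\<close>, the sum of the signs is
  \<open>2 * k - n\<close>; these are its moments of order 0, 2 and 4, times
  \<open>2 ^ n\<close>.\<close>

lemma binomial_moments:
  "(\<Sum>k\<le>n. real (n choose k)) = 2 ^ n"
  "(\<Sum>k\<le>n. real (n choose k) * (2 * real k - real n)\<^sup>2) = 2 ^ n * real n"
  "(\<Sum>k\<le>n. real (n choose k) * (2 * real k - real n) ^ 4) = 2 ^ n * (3 * (real n)\<^sup>2 - 2 * real n)"
proof -
  show M0: "(\<Sum>k\<le>n. real (n choose k)) = 2 ^ n" for n
    using choose_row_sum[of n] by (metis of_nat_sum of_nat_power of_nat_numeral)
  \<comment> \<open>Pascal's rule appends one more sign, moving the sum by \<open>- 1\<close> or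
    \<open>1\<close>. For even \<open>j\<close> the odd powers then cancel, so each moment obeys a
    recursion in the lower even ones.\<close>
  have step: "(\<Sum>k\<le>Suc n. real (Suc n choose k) * (2 * real k - real (Suc n)) ^ j) =
     (\<Sum>k\<le>n. real (n choose k) * (((2 * real k - real n) - 1) ^ j + ((2 * real k - real n) + 1) ^ j))" for n j
  proof -
    have e: "2 * real k - real (Suc n) = 2 * real k - real n - 1"
      "2 * real (Suc k) - real (Suc n) = 2 * real k - real n + 1" for k
      by auto
    show ?thesis
      unfolding distrib_left sum.distrib e(1)[symmetric] e(2)[symmetric]
      by (rule sum_binomial_Suc)
  qed
  show M2: "(\<Sum>k\<le>n. real (n choose k) * (2 * real k - real n)\<^sup>2) = 2 ^ n * real n" for n
  proof (induction n)
    case (Suc n)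
    have "(x - 1)\<^sup>2 + (x + 1)\<^sup>2 = 2 * x\<^sup>2 + 2" for x :: real
      by (simp add: eval_nat_numeral algebra_simps)
    hence "(\<Sum>k\<le>Suc n. real (Suc n choose k) * (2 * real k - real (Suc n))\<^sup>2) =
      2 * (\<Sum>k\<le>n. real (n choose k) * (2 * real k - real n)\<^sup>2) + 2 * (\<Sum>k\<le>n. real (n choose k))"
      by (simp only: step) (simp add: distrib_left sum.distrib sum_distrib_left mult_ac)
    thus ?case by (simp only: Suc M0) (simp add: algebra_simps)
  qed simp
  show "(\<Sum>k\<le>n. real (n choose k) * (2 * real k - real n) ^ 4) = 2 ^ n * (3 * (real n)\<^sup>2 - 2 * real n)"
  proof (induction n)
    case (Suc n)
    have "(x - 1) ^ 4 + (x + 1) ^ 4 = 2 * x ^ 4 + 12 * x\<^sup>2 + 2" for x :: real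
      by (simp add: eval_nat_numeral algebra_simps)
    hence "(\<Sum>k\<le>Suc n. real (Suc n choose k) * (2 * real k - real (Suc n)) ^ 4) =
      2 * (\<Sum>k\<le>n. real (n choose k) * (2 * real k - real n) ^ 4)
      + 12 * (\<Sum>k\<le>n. real (n choose k) * (2 * real k - real n)\<^sup>2) + 2 * (\<Sum>k\<le>n. real (n choose k))"
      by (simp only: step) (simp add: distrib_left sum.distrib sum_distrib_left mult_ac)
    thus ?case by (simp only: Suc M0 M2) (simp add: algebra_simps power2_eq_square)
  qed simp
qed

text \<open>The profile starts at \<open>Phi (- b)\<close> and tends to \<open>1 / 2\<close>, so the
  intermediate value theorem supplies a root; strict growth in the modulus makes it unique.\<close>

lemma ex1_keep_profile_eq:
  assumes b: "b > 0" and r: "Phi (- b) < r" "r < 1 / 2"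
  shows "\<exists>!x. x > 0 \<and> keep_profile b x = r"
proof (rule ex_ex1I)
  have "eventually (\<lambda>v. r < keep_profile b v \<and> 0 \<le> v) at_top"
    using order_tendstoD(1)[OF keep_profile_at_top r(2)] eventually_ge_at_top[of 0]
    by (rule eventually_conj)
  then obtain v where v: "r < keep_profile b v" "0 \<le> v"
    using eventually_happens'[OF trivial_limit_at_top_linorder] by blast
  have "continuous_on {0..v} (keep_profile b)"
    by (rule DERIV_continuous_on, rule has_field_derivative_at_within, rule DERIV_keep_profile)
  hence "\<exists>x\<ge>0. x \<le> v \<and> keep_profile b x = r"
    using v r by (intro IVT') simp_all
  then obtain x where x: "0 \<le> x" "keep_profile b x = r" by blast
  with r have "x \<noteq> 0" by auto
  with x show "\<exists>x. x > 0 \<and> keep_profile b x = r" by (intro exI[of _ x]) simp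
next
  fix x y assume xy: "x > 0 \<and> keep_profile b x = r" "y > 0 \<and> keep_profile b y = r"
  have "\<not> \<bar>x\<bar> < \<bar>y\<bar>" "\<not> \<bar>y\<bar> < \<bar>x\<bar>"
    unfolding keep_profile_less_iff[OF b, symmetric] using xy by simp_all
  thus "x = y" using xy by linarith
qed

section \<open>The RECENTER risk as an average of KEEP profiles\<close>

definition recenter_profile :: "real \<Rightarrow> nat \<Rightarrow> real" where
  "recenter_profile a n = (\<Sum>k\<le>n. real (n choose k) *
     Phi ((a * (2 * real k - real n) / real n - a) / sqrt (1 + 1 / real n))) / 2 ^ n"

text \<open>The noise of the fresh point and that of the batch mean add up to variance
  \<open>\<sigma>\<^sup>2 * (1 + 1 / n)\<close>; for \<open>a = \<mu> / \<sigma>\<close> this is the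
  resulting signal-to-noise ratio.\<close>

definition shrunk :: "real \<Rightarrow> nat \<Rightarrow> real" where
  "shrunk a n = a / sqrt (1 + 1 / real n)"

lemma shrunk_pos: "a > 0 \<Longrightarrow> shrunk a n > 0"
  by (simp add: shrunk_def add_pos_nonneg)

lemma shrunk_less: "a > 0 \<Longrightarrow> n \<ge> 1 \<Longrightarrow> shrunk a n < a"
  by (simp add: shrunk_def pos_divide_less_eq add_pos_nonneg)

text \<open>The terms for \<open>k\<close> and \<open>n - k\<close> are averaged.\<close>

lemma recenter_profile_eq:
  assumes "n \<ge> 1"
  shows "recenter_profile a n = (\<Sum>k\<le>n. real (n choose k) *
    keep_profile (shrunk a n) (shrunk a n * (2 * real k - real n) / real n)) / 2 ^ n"
proof -
  define b where "b = shrunk a n"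
  define h where "h w = Phi (b * w / real n - b)" for w
  define S where "S = (\<Sum>k\<le>n. real (n choose k) * h (2 * real k - real n))"
  have n: "real n > 0" using assms by simp
  have "(a * w / real n - a) / sqrt (1 + 1 / real n) = b * w / real n - b" for w
    by (simp add: b_def shrunk_def diff_divide_distrib)
  hence R: "recenter_profile a n = S / 2 ^ n"
    by (simp add: recenter_profile_def S_def h_def)
  have "S = (\<Sum>k\<le>n. real (n choose k) * h (- (2 * real k - real n)))"
    unfolding S_def
    by (rule sum.reindex_bij_witness[of _ "\<lambda>k. n - k" "\<lambda>k. n - k"])
       (auto simp: binomial_symmetric[symmetric])
  hence "S = (S + (\<Sum>k\<le>n. real (n choose k) * h (- (2 * real k - real n)))) / 2"
    by simp
  also have "\<dots> = (\<Sum>k\<le>n. real (n choose k) * keep_profile b (b * (2 * real k - real n) / real n))"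
    unfolding S_def sum.distrib[symmetric] sum_divide_distrib
  proof (intro sum.cong refl)
    fix k
    show "(real (n choose k) * h (2 * real k - real n) + real (n choose k) * h (- (2 * real k - real n))) / 2
      = real (n choose k) * keep_profile b (b * (2 * real k - real n) / real n)"
      unfolding h_def keep_profile_def mult_minus_right minus_divide_left[symmetric]
      by (simp add: distrib_left)
  qed
  finally show ?thesis unfolding R b_def by simp
qed

text \<open>Each averaged profile is at least its value \<open>Phi (- b)\<close> at 0. Strictness
  comes from the added noise, which makes \<open>b < a\<close>.\<close>

lemma recenter_profile_gt:
  assumes a: "a > 0" and n: "n \<ge> 1"
  shows "Phi (- a) < recenter_profile a n"
proof -
  define b where "b = shrunk a n"
  have b: "0 < b" "b < a" using a n shrunk_pos shrunk_less by (auto simp: b_def)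
  have "Phi (- b) \<le> keep_profile b w" for w
    using keep_profile_less_iff[OF b(1), of w 0] by simp
  hence "(\<Sum>k\<le>n. real (n choose k) * Phi (- b)) \<le>
      (\<Sum>k\<le>n. real (n choose k) * keep_profile b (b * (2 * real k - real n) / real n))"
    by (intro sum_mono mult_left_mono) auto
  hence "Phi (- b) \<le> recenter_profile a n"
    unfolding recenter_profile_eq[OF n] b_def[symmetric] sum_distrib_right[symmetric] binomial_moments(1)
    by (simp add: pos_le_divide_eq mult.commute)
  with strict_mono_Phi[of "- a" "- b"] b show ?thesis by simp
qed

lemma recenter_profile_less_half:
  assumes a: "a > 0" and n: "n \<ge> 1"
  shows "recenter_profile a n < 1 / 2"
proof -
  have "(\<Sum>k\<le>n. real (n choose k) *
      keep_profile (shrunk a n) (shrunk a n * (2 * real k - real n) / real n)) <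
      (\<Sum>k\<le>n. real (n choose k) * (1 / 2))"
    using keep_profile_less_half[OF shrunk_pos[OF a]]
    by (intro sum_strict_mono mult_strict_left_mono) auto
  thus ?thesis
    unfolding recenter_profile_eq[OF n] sum_distrib_right[symmetric] binomial_moments(1)
    by (simp add: pos_divide_less_eq)
qed

text \<open>The fourth-order expansion is averaged over the sign sums: the second moment produces
  the \<open>1 / n\<close> term and the fourth moment bounds the error.\<close>

lemma recenter_profile_expansion:
  assumes a: "a > 0" and n: "n \<ge> 1"
  defines "b \<equiv> shrunk a n"
  shows "\<bar>recenter_profile a n - (Phi (- b) + b ^ 3 * std_normal_density b / (2 * real n))\<bar>
    \<le> 3 * (6 * a + 8 * a ^ 3) * a ^ 4 / (real n)\<^sup>2"
proof -
  \<comment> \<open>This is \<open>3 * B + B ^ 3\<close> at \<open>B = 2 * a\<close>, which bounds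
    \<open>\<bar>b\<bar> + \<bar>w k\<bar>\<close> since a mean of signs has modulus at most
    1.\<close>
  define C where "C = 6 * a + 8 * a ^ 3"
  define m where "m k = 2 * real k - real n" for k
  define w where "w k = b * m k / real n" for k
  define q where "q = b * std_normal_density b / 2"
  have b: "0 < b" "b < a" using a n shrunk_pos shrunk_less by (auto simp: b_def)
  have C: "C \<ge> 0" using a by (simp add: C_def)
  have n': "real n > 0" using n by simp
  have w2: "(\<Sum>k\<le>n. real (n choose k) * (w k)\<^sup>2) = 2 ^ n * (b\<^sup>2 / real n)"
  proof -
    have "(\<Sum>k\<le>n. real (n choose k) * (w k)\<^sup>2) = (\<Sum>k\<le>n. real (n choose k) * (m k)\<^sup>2) * (b\<^sup>2 / (real n)\<^sup>2)"
      unfolding sum_distrib_right w_def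
      by (intro sum.cong refl) (simp add: power_mult_distrib power_divide)
    thus ?thesis unfolding m_def binomial_moments(2) using n' by (simp add: power2_eq_square)
  qed
  have w4: "(\<Sum>k\<le>n. real (n choose k) * (w k) ^ 4) \<le> 2 ^ n * (3 * a ^ 4 / (real n)\<^sup>2)"
  proof -
    \<comment> \<open>From \<open>n \<le> n\<^sup>2\<close> the factor
      \<open>3 * n\<^sup>2 - 2 * n\<close> is nonnegative, as the product estimate below
      requires.\<close>
    have nn: "real n * 1 \<le> real n * real n"
      using n by (intro mult_left_mono) auto
    have "(\<Sum>k\<le>n. real (n choose k) * (w k) ^ 4) = (\<Sum>k\<le>n. real (n choose k) * (m k) ^ 4) * (b ^ 4 / (real n) ^ 4)"
      unfolding sum_distrib_right w_def
      by (intro sum.cong refl) (simp add: power_mult_distrib power_divide)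
    also have "\<dots> = 2 ^ n * (3 * (real n)\<^sup>2 - 2 * real n) * (b ^ 4 / (real n) ^ 4)"
      by (simp add: m_def binomial_moments(3))
    also have "\<dots> \<le> 2 ^ n * (3 * (real n)\<^sup>2) * (a ^ 4 / (real n) ^ 4)"
      using b nn unfolding power2_eq_square by (intro mult_mono divide_right_mono power_mono) auto
    also have "\<dots> = 2 ^ n * (3 * a ^ 4 / (real n)\<^sup>2)"
      using n' by (simp add: power4_eq_xxxx power2_eq_square)
    finally show ?thesis .
  qed
  have approx: "\<bar>keep_profile b (w k) - (Phi (- b) + q * (w k)\<^sup>2)\<bar> \<le> C * (w k) ^ 4" if "k \<le> n" for k
  proof -
    have "\<bar>m k\<bar> \<le> real n" using that by (auto simp: m_def)
    hence "\<bar>m k / real n\<bar> \<le> 1" using n' by simp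
    hence "\<bar>b\<bar> * \<bar>m k / real n\<bar> \<le> a * 1" using b by (intro mult_mono) auto
    hence "\<bar>b\<bar> + \<bar>w k\<bar> \<le> 2 * a" using b by (simp add: w_def abs_mult)
    from keep_profile_expansion[OF this] show ?thesis
      by (simp add: C_def q_def power_mult_distrib)
  qed
  have "2 ^ n * (recenter_profile a n - (Phi (- b) + b ^ 3 * std_normal_density b / (2 * real n))) =
      (\<Sum>k\<le>n. real (n choose k) * keep_profile b (w k))
      - (Phi (- b) * (\<Sum>k\<le>n. real (n choose k)) + q * (\<Sum>k\<le>n. real (n choose k) * (w k)\<^sup>2))"
    unfolding w2 binomial_moments(1) recenter_profile_eq[OF n] b_def[symmetric] m_def[symmetric] w_def[symmetric] q_def
    by (simp add: algebra_simps power2_eq_square power3_eq_cube)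
  also have "\<dots> = (\<Sum>k\<le>n. real (n choose k) * (keep_profile b (w k) - (Phi (- b) + q * (w k)\<^sup>2)))"
    unfolding sum_distrib_left sum.distrib[symmetric] sum_subtractf[symmetric]
    by (intro sum.cong refl) (simp add: algebra_simps)
  finally have eq: "2 ^ n * (recenter_profile a n - (Phi (- b) + b ^ 3 * std_normal_density b / (2 * real n))) =
      (\<Sum>k\<le>n. real (n choose k) * (keep_profile b (w k) - (Phi (- b) + q * (w k)\<^sup>2)))" .
  have "2 ^ n * \<bar>recenter_profile a n - (Phi (- b) + b ^ 3 * std_normal_density b / (2 * real n))\<bar> =
      \<bar>2 ^ n * (recenter_profile a n - (Phi (- b) + b ^ 3 * std_normal_density b / (2 * real n)))\<bar>"
    by (simp only: abs_mult) simp
  also have "\<dots> = \<bar>\<Sum>k\<le>n. real (n choose k) * (keep_profile b (w k) - (Phi (- b) + q * (w k)\<^sup>2))\<bar>"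
    by (simp only: eq)
  also have "\<dots> \<le> (\<Sum>k\<le>n. real (n choose k) * (C * (w k) ^ 4))"
    using approx by (intro order_trans[OF sum_abs] sum_mono) (auto simp: abs_mult intro!: mult_left_mono)
  also have "\<dots> = C * (\<Sum>k\<le>n. real (n choose k) * (w k) ^ 4)"
    by (simp add: sum_distrib_left mult_ac)
  also have "\<dots> \<le> C * (2 ^ n * (3 * a ^ 4 / (real n)\<^sup>2))"
    using w4 C by (rule mult_left_mono)
  also have "\<dots> = 2 ^ n * (3 * C * a ^ 4 / (real n)\<^sup>2)" by simp
  finally show ?thesis
    unfolding C_def by (simp only: mult_le_cancel_left_pos zero_less_power zero_less_numeral)
qed

section \<open>Asymptotics of the two risks and of the crossing point\<close>

lemma recenter_profile_asymp:
  assumes a: "a > 0"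
  shows "(\<lambda>n. recenter_profile a n - (Phi (- a) + a * (1 + a\<^sup>2) * std_normal_density a / 2 / real n))
    \<in> O(\<lambda>n. 1 / (real n)\<^sup>2)"
proof -
  let ?\<phi> = std_normal_density and ?b = "shrunk a"
  have 1: "(\<lambda>n. recenter_profile a n - (Phi (- ?b n) + ?b n ^ 3 * ?\<phi> (?b n) / (2 * real n))) \<in> O(\<lambda>n. 1 / (real n)\<^sup>2)"
    using recenter_profile_expansion[OF a]
    by (intro bigoI[of _ "3 * (6 * a + 8 * a ^ 3) * a ^ 4"] eventually_mono[OF eventually_ge_at_top[of 1]]) auto
  have "(\<lambda>n. Phi (- ?b n) - (Phi (- a) + ?\<phi> a * (a - ?b n))) \<in> O(\<lambda>n. (a - ?b n)\<^sup>2)"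
    using Phi_expansion[of "?b _" a] shrunk_pos[OF a] shrunk_less[OF a]
    by (intro bigoI[of _ a] eventually_mono[OF eventually_ge_at_top[of 1]]) (auto simp: less_imp_le)
  also have "(\<lambda>n. (a - ?b n)\<^sup>2) \<in> O(\<lambda>n. 1 / (real n)\<^sup>2)"
    unfolding shrunk_def using a by real_asymp
  finally have 2: "(\<lambda>n. Phi (- ?b n) - (Phi (- a) + ?\<phi> a * (a - ?b n))) \<in> O(\<lambda>n. 1 / (real n)\<^sup>2)" .
  have 3: "(\<lambda>n. ?\<phi> a * (a - ?b n - a / (2 * real n))) \<in> O(\<lambda>n. 1 / (real n)\<^sup>2)"
  proof -
    have "(\<lambda>n. a - ?b n - a / (2 * real n)) \<in> O(\<lambda>n. 1 / (real n)\<^sup>2)"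
      unfolding shrunk_def using a by real_asymp
    thus ?thesis using normal_density_pos[of 1 0 a] by simp
  qed
  have 4: "(\<lambda>n. ?b n ^ 3 * ?\<phi> (?b n) / (2 * real n) - a ^ 3 * ?\<phi> a / (2 * real n)) \<in> O(\<lambda>n. 1 / (real n)\<^sup>2)"
    unfolding shrunk_def std_normal_density_def using a by real_asymp
  \<comment> \<open>The coefficient of \<open>1 / n\<close> has two sources: the lower
    signal-to-noise ratio, through \<open>a - b = a / (2 * n)\<close> up to
    \<open>O(1 / n\<^sup>2)\<close>, and the fluctuation of the threshold, through the cubic term.
    The four error terms then telescope.\<close>
  have id: "a * (1 + a\<^sup>2) * ?\<phi> a / 2 / real n
      = ?\<phi> a * (a / (2 * real n)) + a ^ 3 * ?\<phi> a / (2 * real n)" for n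
    by (simp add: distrib_left distrib_right add_divide_distrib power2_eq_square power3_eq_cube mult_ac)
  have "recenter_profile a n - (Phi (- a) + a * (1 + a\<^sup>2) * ?\<phi> a / 2 / real n) =
      (recenter_profile a n - (Phi (- ?b n) + ?b n ^ 3 * ?\<phi> (?b n) / (2 * real n)))
      + (Phi (- ?b n) - (Phi (- a) + ?\<phi> a * (a - ?b n)))
      + ?\<phi> a * (a - ?b n - a / (2 * real n))
      + (?b n ^ 3 * ?\<phi> (?b n) / (2 * real n) - a ^ 3 * ?\<phi> a / (2 * real n))" for n
    unfolding id right_diff_distrib by linarith
  thus ?thesis by (simp only:) (intro sum_in_bigo 1 2 3 4)
qed

text \<open>The shift is chosen so that its square \<open>(a\<^sup>2 + 1) / n\<close> turns the
  quadratic Taylor term into exactly the \<open>1 / n\<close> term of the RECENTER risk.\<close>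

lemma keep_profile_asymp:
  assumes a: "a > 0"
  shows "(\<lambda>n. keep_profile a (sqrt (a\<^sup>2 + 1) / sqrt (real n))
      - (Phi (- a) + a * (1 + a\<^sup>2) * std_normal_density a / 2 / real n)) \<in> O(\<lambda>n. 1 / (real n)\<^sup>2)"
proof -
  define s where "s = sqrt (a\<^sup>2 + 1)"
  have s2: "s\<^sup>2 = a\<^sup>2 + 1" by (simp add: s_def)
  have s: "s > 0" by (simp add: s_def add_nonneg_pos)
  \<comment> \<open>Once the argument is at most 1, \<open>B = a + 1\<close> serves for all
    \<open>n\<close> in the remainder bound.\<close>
  have "eventually (\<lambda>n. s / sqrt (real n) \<le> 1) at_top" by real_asymp
  hence "(\<lambda>n. keep_profile a (s / sqrt (real n))
      - (Phi (- a) + a * std_normal_density a / 2 * (s / sqrt (real n))\<^sup>2)) \<in> O(\<lambda>n. (s / sqrt (real n)) ^ 4)"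
    using a keep_profile_expansion[of a "s / sqrt (real _)" "a + 1"]
    by (intro bigoI[of _ "3 * (a + 1) + (a + 1) ^ 3"]) (auto elim!: eventually_mono simp: s_def)
  also have "(\<lambda>n. (s / sqrt (real n)) ^ 4) \<in> O(\<lambda>n. 1 / (real n)\<^sup>2)"
    using s by real_asymp
  also have "(\<lambda>n. a * std_normal_density a / 2 * (s / sqrt (real n))\<^sup>2)
      = (\<lambda>n. a * (1 + a\<^sup>2) * std_normal_density a / 2 / real n)"
    by (simp add: fun_eq_iff power_divide s2 add.commute)
  finally show ?thesis by (simp only: s_def)
qed

text \<open>The profile values at \<open>x n\<close> and \<open>y n\<close> differ by
  \<open>O(1 / n\<^sup>2)\<close>, so by \<open>keep_profile_diff_ge\<close> their squares do too.
  Dividing by \<open>y n\<close>, of order \<open>n powr (-1/2)\<close>, gives the stated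
  rate.\<close>

lemma critical_point_asymp:
  assumes a: "a > 0" and x: "\<And>n. n \<ge> 1 \<Longrightarrow> x n > 0 \<and> keep_profile a (x n) = recenter_profile a n"
  shows "(\<lambda>n. x n - sqrt (a\<^sup>2 + 1) / sqrt (real n)) \<in> O(\<lambda>n. real n powr (-3/2))"
proof -
  define s where "s = sqrt (a\<^sup>2 + 1)"
  define y where "y n = s / sqrt (real n)" for n :: nat
  define r where "r n = Phi (- a) + a * (1 + a\<^sup>2) * std_normal_density a / 2 / real n" for n :: nat
  define c where "c = std_normal_density a * exp (- 1 / 2) * a / 4"
  have s: "s > 0" by (simp add: s_def add_nonneg_pos)
  have c: "c > 0" using a by (simp add: c_def normal_density_pos)
  have R: "(\<lambda>n. recenter_profile a n - r n) \<in> O(\<lambda>n. 1 / (real n)\<^sup>2)"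
    using recenter_profile_asymp[OF a] by (simp only: r_def)
  have K: "(\<lambda>n. keep_profile a (y n) - r n) \<in> O(\<lambda>n. 1 / (real n)\<^sup>2)"
    using keep_profile_asymp[OF a] by (simp only: r_def y_def s_def)
  have D: "(\<lambda>n. recenter_profile a n - keep_profile a (y n)) \<in> O(\<lambda>n. 1 / (real n)\<^sup>2)"
    using sum_in_bigo(2)[OF R K] by simp
  have y1: "eventually (\<lambda>n. y n < 1) at_top"
    unfolding y_def by real_asymp
  \<comment> \<open>The limit lies below \<open>keep_profile a 1\<close>, which eventually forces
    \<open>x n < 1\<close>, the range where the quadratic lower bound applies.\<close>
  have "recenter_profile a \<longlonglongrightarrow> Phi (- a)"
  proof -
    have "(\<lambda>n. recenter_profile a n - r n) \<in> o(\<lambda>_. 1)"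
      by (rule landau_o.big_small_trans[OF R]) real_asymp
    from smalloD_tendsto[OF this] have "(\<lambda>n. recenter_profile a n - r n) \<longlonglongrightarrow> 0" by simp
    moreover have "r \<longlonglongrightarrow> Phi (- a)" unfolding r_def
      using tendsto_add[OF tendsto_const[of "Phi (- a)"]
          lim_const_over_n[of "a * (1 + a\<^sup>2) * std_normal_density a / 2"]]
      by (simp only: add_0_right)
    ultimately have "(\<lambda>n. (recenter_profile a n - r n) + r n) \<longlonglongrightarrow> 0 + Phi (- a)"
      by (rule tendsto_add)
    thus ?thesis by simp
  qed
  moreover have "Phi (- a) < keep_profile a 1"
    using keep_profile_less_iff[OF a, of 0 1] by simp
  ultimately have "eventually (\<lambda>n. recenter_profile a n < keep_profile a 1) at_top"
    by (rule order_tendstoD(2))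
  hence "eventually (\<lambda>n. \<bar>x n - y n\<bar> \<le> 1 / c * \<bar>(recenter_profile a n - keep_profile a (y n)) * (1 / y n)\<bar>) at_top"
    using y1 eventually_ge_at_top[of 1]
  proof eventually_elim
    case (elim n)
    have x: "x n > 0" "keep_profile a (x n) = recenter_profile a n" using x elim by auto
    have x1: "x n < 1"
      using keep_profile_less_iff[OF a, of "x n" 1] elim x by simp
    have y: "y n > 0" using elim s by (simp add: y_def)
    have "c * \<bar>x n - y n\<bar> * (x n + y n) \<le> \<bar>keep_profile a (x n) - keep_profile a (y n)\<bar>"
    proof (cases "y n \<le> x n")
      case True
      hence "c * \<bar>x n - y n\<bar> * (x n + y n) = c * ((x n)\<^sup>2 - (y n)\<^sup>2)"
        by (simp add: algebra_simps power2_eq_square)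
      thus ?thesis
        using keep_profile_diff_ge[OF a, of "y n" "x n"] True x1 y unfolding c_def[symmetric] by linarith
    next
      case False
      hence "c * \<bar>x n - y n\<bar> * (x n + y n) = c * ((y n)\<^sup>2 - (x n)\<^sup>2)"
        by (simp add: algebra_simps power2_eq_square)
      thus ?thesis
        using keep_profile_diff_ge[OF a, of "x n" "y n"] False elim x unfolding c_def[symmetric] by linarith
    qed
    \<comment> \<open>Replacing \<open>x n + y n\<close> by \<open>y n\<close> leaves a divisor
      whose order is known.\<close>
    moreover have "c * \<bar>x n - y n\<bar> * y n \<le> c * \<bar>x n - y n\<bar> * (x n + y n)"
      using x c by (intro mult_left_mono) auto
    ultimately have "c * \<bar>x n - y n\<bar> * y n \<le> \<bar>recenter_profile a n - keep_profile a (y n)\<bar>"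
      unfolding x(2) by linarith
    hence "\<bar>x n - y n\<bar> \<le> \<bar>recenter_profile a n - keep_profile a (y n)\<bar> / (c * y n)"
      using c y by (simp add: pos_le_divide_eq mult_ac)
    also have "\<dots> = 1 / c * \<bar>(recenter_profile a n - keep_profile a (y n)) * (1 / y n)\<bar>"
      using y by (simp add: abs_mult)
    finally show ?case .
  qed
  hence "(\<lambda>n. x n - y n) \<in> O(\<lambda>n. (recenter_profile a n - keep_profile a (y n)) * (1 / y n))"
    by (intro bigoI[of _ "1 / c"]) simp
  also have "(\<lambda>n. (recenter_profile a n - keep_profile a (y n)) * (1 / y n)) \<in> O(\<lambda>n. 1 / (real n)\<^sup>2 * (1 / y n))"
    using D by (rule landau_o.big.mult_right)
  also have "(\<lambda>n. 1 / (real n)\<^sup>2 * (1 / y n)) \<in> O(\<lambda>n. real n powr (-3/2))"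
    unfolding y_def using s by real_asymp
  finally show ?thesis by (simp only: y_def s_def)
qed

section \<open>Return to the risks and the critical shift\<close>

lemma keep_risk_eq_profile:
  "\<sigma> > 0 \<Longrightarrow> keep_risk \<mu> \<sigma> \<delta> = keep_profile (\<mu> / \<sigma>) (\<delta> / \<sigma>)"
proof -
  assume "\<sigma> > 0"
  moreover have "- (\<mu> + \<delta>) / \<sigma> = - (\<delta> / \<sigma>) - \<mu> / \<sigma>"
    by (simp add: diff_divide_distrib add_divide_distrib)
  ultimately show ?thesis
    by (simp only: keep_risk_closed_form keep_profile_def diff_divide_distrib) (simp add: add.commute)
qed

lemma recenter_risk_eq_profile:
  "\<sigma> > 0 \<Longrightarrow> n \<ge> 1 \<Longrightarrow> recenter_risk \<mu> \<sigma> \<delta> n = recenter_profile (\<mu> / \<sigma>) n"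
proof -
  assume "\<sigma> > 0" "n \<ge> 1"
  moreover have "(\<mu> * w / real n - \<mu>) / (\<sigma> * s) = (\<mu> / \<sigma> * w / real n - \<mu> / \<sigma>) / s" for w s
    by (simp add: diff_divide_distrib)
  ultimately show ?thesis
    by (simp only: recenter_risk_closed_form recenter_profile_def) simp
qed

theorem theorem3:
  fixes \<mu> \<sigma> :: real
  assumes "\<mu> > 0" and "\<sigma> > 0"
  shows "(\<forall>n\<ge>1. \<exists>!d. d > 0 \<and> keep_risk \<mu> \<sigma> d = recenter_risk \<mu> \<sigma> d n) \<and>
    (\<forall>n\<ge>1. \<forall>\<delta>.
       (\<bar>\<delta>\<bar> < critical_shift \<mu> \<sigma> n \<longrightarrow> keep_risk \<mu> \<sigma> \<delta> < recenter_risk \<mu> \<sigma> \<delta> n) \<and>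
       (\<bar>\<delta>\<bar> > critical_shift \<mu> \<sigma> n \<longrightarrow> keep_risk \<mu> \<sigma> \<delta> > recenter_risk \<mu> \<sigma> \<delta> n)) \<and>
    (\<lambda>n. critical_shift \<mu> \<sigma> n - sqrt (\<mu>\<^sup>2 + \<sigma>\<^sup>2) / sqrt (real n)) \<in> O(\<lambda>n. real n powr (-3/2)) \<and>
    critical_shift \<mu> \<sigma> \<in> \<Theta>(\<lambda>n. real n powr (-1/2))"
proof -
  define a where "a = \<mu> / \<sigma>"
  have a: "a > 0" using assms by (simp add: a_def)
  note risks = keep_risk_eq_profile[OF assms(2), of \<mu>, folded a_def]
    recenter_risk_eq_profile[OF assms(2), of _ \<mu>, folded a_def]
  have ex1: "\<exists>!d. d > 0 \<and> keep_risk \<mu> \<sigma> d = recenter_risk \<mu> \<sigma> d n" if n: "n \<ge> 1" for n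
  proof -
    have "\<exists>!x. x > 0 \<and> keep_profile a x = recenter_profile a n"
      using ex1_keep_profile_eq[OF a recenter_profile_gt[OF a n] recenter_profile_less_half[OF a n]] .
    then obtain x where x: "x > 0" "keep_profile a x = recenter_profile a n"
      and uniq: "\<And>x'. x' > 0 \<Longrightarrow> keep_profile a x' = recenter_profile a n \<Longrightarrow> x' = x" by blast
    show ?thesis
    proof (rule ex1I[of _ "\<sigma> * x"])
      fix d assume "d > 0 \<and> keep_risk \<mu> \<sigma> d = recenter_risk \<mu> \<sigma> d n"
      hence "d / \<sigma> = x" using assms(2) n by (intro uniq) (auto simp: risks)
      thus "d = \<sigma> * x" using assms(2) by (simp add: field_simps)
    qed (use x n assms(2) in \<open>simp add: risks\<close>)
  qed
  define x where "x n = critical_shift \<mu> \<sigma> n / \<sigma>" for n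
  have cs: "critical_shift \<mu> \<sigma> n = \<sigma> * x n" for n
    using assms by (simp add: x_def)
  \<comment> \<open>Unique existence entitles the definite description in
    \<open>critical_shift\<close> to its defining property, here divided by the noise level.\<close>
  have x: "x n > 0 \<and> keep_profile a (x n) = recenter_profile a n" if n: "n \<ge> 1" for n
    using theI'[OF ex1[OF n]] n assms(2) unfolding critical_shift_def[symmetric]
    by (simp add: risks x_def)
  have less: "(\<bar>\<delta>\<bar> < critical_shift \<mu> \<sigma> n \<longrightarrow> keep_risk \<mu> \<sigma> \<delta> < recenter_risk \<mu> \<sigma> \<delta> n) \<and>
       (\<bar>\<delta>\<bar> > critical_shift \<mu> \<sigma> n \<longrightarrow> keep_risk \<mu> \<sigma> \<delta> > recenter_risk \<mu> \<sigma> \<delta> n)" if n: "n \<ge> 1" for n \<delta>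
  proof -
    \<comment> \<open>The RECENTER risk is the KEEP profile at \<open>x n\<close>, so both
      implications reduce to comparing moduli.\<close>
    have "\<bar>\<delta>\<bar> < critical_shift \<mu> \<sigma> n \<longleftrightarrow> keep_profile a (\<delta> / \<sigma>) < keep_profile a (x n)"
      "\<bar>\<delta>\<bar> > critical_shift \<mu> \<sigma> n \<longleftrightarrow> keep_profile a (\<delta> / \<sigma>) > keep_profile a (x n)"
      using x[OF n] assms(2)
      unfolding keep_profile_less_iff[OF a]
      by (simp_all add: cs pos_divide_less_eq pos_less_divide_eq mult.commute)
    thus ?thesis
      using x[OF n] n by (simp add: risks)
  qed
  have sqrt_eq: "sqrt (\<mu>\<^sup>2 + \<sigma>\<^sup>2) = \<sigma> * sqrt (a\<^sup>2 + 1)"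
    using assms by (intro real_sqrt_unique) (auto simp: a_def field_simps)
  have "(\<lambda>n. \<sigma> * (x n - sqrt (a\<^sup>2 + 1) / sqrt (real n))) \<in> O(\<lambda>n. real n powr (-3/2))"
    using critical_point_asymp[OF a x] assms(2) by simp
  hence O: "(\<lambda>n. critical_shift \<mu> \<sigma> n - sqrt (\<mu>\<^sup>2 + \<sigma>\<^sup>2) / sqrt (real n)) \<in> O(\<lambda>n. real n powr (-3/2))"
    by (simp add: cs sqrt_eq right_diff_distrib)
  define A where "A = sqrt (\<mu>\<^sup>2 + \<sigma>\<^sup>2)"
  have A: "A > 0" using assms by (simp add: A_def add_pos_pos)
  \<comment> \<open>The error is of smaller order than the leading term, so the critical shift
    inherits the exact order of that term.\<close>
  have "(\<lambda>n. real n powr (-3/2)) \<in> o(\<lambda>n. A / sqrt (real n))"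
    using A by real_asymp
  with O[folded A_def] have "(\<lambda>n. critical_shift \<mu> \<sigma> n - A / sqrt (real n))
      \<in> o(\<lambda>n. A / sqrt (real n))"
    by (rule landau_o.big_small_trans)
  from landau_theta.plus_absorb1[OF this]
  have eq: "\<Theta>(critical_shift \<mu> \<sigma>) = \<Theta>(\<lambda>n. A / sqrt (real n))"
    by simp
  have "critical_shift \<mu> \<sigma> \<in> \<Theta>(\<lambda>n. A / sqrt (real n))"
    by (rule subsetD[OF equalityD1[OF eq] bigtheta_refl])
  also have "(\<lambda>n. A / sqrt (real n)) \<in> \<Theta>(\<lambda>n. real n powr (-1/2))"
    using A by real_asymp
  finally have \<Theta>: "critical_shift \<mu> \<sigma> \<in> \<Theta>(\<lambda>n. real n powr (-1/2))" .
  show ?thesis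
    by (intro conjI[OF _ conjI[OF _ conjI[OF O \<Theta>]]] allI impI ex1 less)
qed

end
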